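(* For all integers $k\geq 2$ and all real $0<\varepsilon<1/60$, \[ 1-8\varepsilon^2\leq \gamma_{k,\varepsilon}\leq 1-\varepsilon^2/72 . \]
   Context: A word over the alphabet $[k]=\{1,\dots,k\}$ is a finite sequence of elements of $[k]$. A subsequence of a word is obtained by deleting some (not necessarily contiguous) symbols. $\mathrm{LCS}(w,w')$ is the length of the longest word that is a subsequence of both $w$ and $w'$. For $k\in\mathbb{N}$ and $0<\varepsilon<1$, \[ \gamma_{k,\varepsilon}=\lim_{n\to\infty}\frac1n\,\mathbb{E}\,\mathrm{LCS}(w,w'), \] where $w$ is a uniformly random word in $[k]^n$ and $w'$ is an independent uniformly random word in $[k]^{(1-\varepsilon)kn}$ (the length $(1-\varepsilon)kn$ is rounded down to an integer; rounding does not affect the limit). The limit exists by superadditivity of $\mathrm{LCS}$ and Fekete's lemma. *)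

theory Defs
  imports "HOL-Probability.Probability" "HOL-Library.Sublist"
begin

definition words :: "nat \<Rightarrow> nat \<Rightarrow> nat list set" where
  "words k n = {w. length w = n \<and> set w \<subseteq> {1..k}}"

definition LCS :: "'a list \<Rightarrow> 'a list \<Rightarrow> nat" where
  "LCS w w' = Max {length u | u. subseq u w \<and> subseq u w'}"

definition expected_LCS :: "nat \<Rightarrow> nat \<Rightarrow> nat \<Rightarrow> real" where
  "expected_LCS k n m =
     measure_pmf.expectation
       (pair_pmf (pmf_of_set (words k n)) (pmf_of_set (words k m)))
       (\<lambda>(w, w'). real (LCS w w'))"

text \<open>For \<open>k \<ge> 1\<close> and \<open>0 < \<epsilon> < 1\<close> the limit exists by superadditivity of \<^const>\<open>LCS\<close>
  and Fekete's lemma; \<^const>\<open>lim\<close> is unspecified on divergent sequences, so bounding it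
  requires proving convergence.\<close>

definition lcs_gamma :: "nat \<Rightarrow> real \<Rightarrow> real" where
  "lcs_gamma k \<epsilon> =
     lim (\<lambda>n. expected_LCS k n (nat \<lfloor>(1 - \<epsilon>) * real k * real n\<rfloor>) / real n)"

end

theory Submission
  imports Defs
begin

text \<open>
  Upper bound.  For a fixed word \<open>w\<close> let \<open>T\<^sub>r(w)\<close> be the length of the shortest prefix of an infinite
  random text that contains \<open>w\<close> with at most \<open>r\<close> letters skipped.  The Laplace transform of
  \<open>T\<^sub>r\<close> is submultiplicative under concatenation, up to the choice of how the \<open>r\<close> skips are
  distributed.  Passing from blocks of length \<open>4\<^sup>s\<close> to blocks of length \<open>4\<^sup>s\<^sup>+\<^sup>1\<close> while halving the
  argument of the transform, Jensen's inequality pays for this choice, so that at length \<open>L \<approx> \<epsilon>\<^sup>-\<^sup>2\<close> each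
  skip costs only a constant factor, instead of the factor \<open>L\<close> of the union bound.  A Chernoff bound over
  consecutive blocks of length \<open>L\<close> finishes the argument.

  Lower bound.  Read the text letter by letter and maintain two greedy matchings of the word, one of which
  has skipped one letter more.  The distance of their positions in the word is a symmetric random walk,
  slowed down when both wait for the same letter, and reflected at \<open>1\<close>, since the skip can be postponed
  when the matchings meet.  In a piece of text of length of order \<open>k \<epsilon>\<^sup>-\<^sup>2\<close> the walk therefore gains
  order \<open>\<epsilon>\<^sup>-\<^sup>1\<close> letters at the price of a single skip.
\<close>

section \<open>Longest common subsequences\<close>

lemma finite_LCS_lengths: "finite {length u | u. subseq u w \<and> subseq u w'}"
proof (rule finite_subset)
  show "{length u | u. subseq u w \<and> subseq u w'} \<subseteq> {..length w}"
    by (auto dest: list_emb_length)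
qed simp

lemma LCS_ge: "subseq x w \<Longrightarrow> subseq x w' \<Longrightarrow> length x \<le> LCS w w'"
  unfolding LCS_def by (rule Max_ge[OF finite_LCS_lengths]) blast

lemma LCS_obtain:
  obtains x where "subseq x w" "subseq x w'" "length x = LCS w w'"
proof -
  have "[] \<in> {u. subseq u w \<and> subseq u w'}" by simp
  then have "{length u | u. subseq u w \<and> subseq u w'} \<noteq> {}" by blast
  from Max_in[OF finite_LCS_lengths this] show ?thesis
    using that unfolding LCS_def by auto
qed

lemma LCS_le_length: "LCS w w' \<le> length w"
  by (rule LCS_obtain[of w w']) (metis list_emb_length)

lemma LCS_mono:
  assumes "subseq w v" "subseq w' v'"
  shows "LCS w w' \<le> LCS v v'"
  by (rule LCS_obtain[of w w']) (metis LCS_ge assms subseq_order.trans)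

lemma LCS_append_ge: "LCS w v + LCS w' v' \<le> LCS (w @ w') (v @ v')"
proof -
  obtain x where x: "subseq x w" "subseq x v" "length x = LCS w v" by (rule LCS_obtain)
  obtain y where y: "subseq y w'" "subseq y v'" "length y = LCS w' v'" by (rule LCS_obtain)
  have "length (x @ y) \<le> LCS (w @ w') (v @ v')"
    using x y by (intro LCS_ge list_emb_append_mono)
  then show ?thesis using x y by simp
qed

lemma LCS_Nil2 [simp]: "LCS w [] = 0"
  by (rule LCS_obtain[of w "[]"]) (metis list_emb_Nil2 list.size(3))

section \<open>Averages over words\<close>

lemma words_0 [simp]: "words k 0 = {[]}"
  by (auto simp: words_def)

lemma words_Suc: "words k (Suc n) = (\<lambda>(c, w). c # w) ` ({1..k} \<times> words k n)"
  by (auto simp: words_def length_Suc_conv image_iff)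

lemma finite_words [simp]: "finite (words k n)"
  by (induction n) (auto simp: words_Suc)

lemma sum_words_Suc: "(\<Sum>w\<in>words k (Suc n). f w) = (\<Sum>c=1..k. \<Sum>w\<in>words k n. f (c # w))"
proof -
  have "inj_on (\<lambda>(c, w). c # w) ({1..k} \<times> words k n)"
    by (auto simp: inj_on_def)
  then show ?thesis
    unfolding words_Suc sum.reindex[OF \<open>inj_on _ _\<close>]
    by (simp add: sum.cartesian_product case_prod_beta)
qed

lemma card_words: "card (words k n) = k ^ n"
proof (induction n)
  case (Suc n)
  have "inj_on (\<lambda>(c, w). c # w) ({1..k} \<times> words k n)"
    by (auto simp: inj_on_def)
  then show ?case using Suc by (simp add: words_Suc card_image card_cartesian_product)
qed simp

definition avg_words :: "nat \<Rightarrow> nat \<Rightarrow> (nat list \<Rightarrow> real) \<Rightarrow> real" where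
  "avg_words k n f = (\<Sum>w\<in>words k n. f w) / real k ^ n"

lemma avg_words_0 [simp]: "avg_words k 0 f = f []"
  by (simp add: avg_words_def)

lemma avg_words_Suc: "avg_words k (Suc n) f = (\<Sum>c=1..k. avg_words k n (\<lambda>w. f (c # w))) / real k"
  unfolding avg_words_def by (simp add: sum_words_Suc sum_divide_distrib field_simps)

lemma avg_words_append:
  "avg_words k (m + n) f = avg_words k m (\<lambda>v. avg_words k n (\<lambda>w. f (v @ w)))"
  by (induction m arbitrary: f) (simp_all add: avg_words_Suc)

lemma avg_words_const [simp]: "k > 0 \<Longrightarrow> avg_words k n (\<lambda>_. c) = c"
  by (simp add: avg_words_def card_words)

lemma avg_words_mono:
  assumes "\<And>w. w \<in> words k n \<Longrightarrow> f w \<le> g w"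
  shows "avg_words k n f \<le> avg_words k n g"
  unfolding avg_words_def by (intro divide_right_mono sum_mono assms) auto

lemma avg_words_cong:
  assumes "\<And>w. w \<in> words k n \<Longrightarrow> f w = g w"
  shows "avg_words k n f = avg_words k n g"
  by (intro antisym avg_words_mono) (simp_all add: assms)

lemma avg_words_add: "avg_words k n (\<lambda>w. f w + g w) = avg_words k n f + avg_words k n g"
  by (simp add: avg_words_def sum.distrib add_divide_distrib)

lemma avg_words_diff: "avg_words k n (\<lambda>w. f w - g w) = avg_words k n f - avg_words k n g"
  by (simp add: avg_words_def sum_subtractf diff_divide_distrib)

lemma avg_words_of_bool:
  "avg_words k m (\<lambda>u. of_bool (P u)) = real (card {u \<in> words k m. P u}) / real k ^ m"
  by (simp add: avg_words_def of_bool_def sum.If_cases Int_def)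

lemma avg_words_mult: "avg_words k n (\<lambda>w. c * f w) = c * avg_words k n f"
  by (simp add: avg_words_def sum_distrib_left)

lemma avg_words_sum: "avg_words k n (\<lambda>w. \<Sum>i\<in>I. f i w) = (\<Sum>i\<in>I. avg_words k n (f i))"
proof -
  have "(\<Sum>w\<in>words k n. \<Sum>i\<in>I. f i w) = (\<Sum>i\<in>I. \<Sum>w\<in>words k n. f i w)"
    by (rule sum.swap)
  then show ?thesis by (simp add: avg_words_def sum_divide_distrib)
qed

lemma avg_words_divide: "avg_words k n (\<lambda>w. f w / c) = avg_words k n f / c"
  by (simp add: avg_words_def sum_divide_distrib field_simps)

lemma avg_avg_words_Suc:
  "avg_words k W (\<lambda>w. avg_words k (Suc m) (F w)) =
    (\<Sum>y=1..k. avg_words k W (\<lambda>w. avg_words k m (\<lambda>u. F w (y # u)))) / real k"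
  by (simp add: avg_words_Suc avg_words_sum avg_words_divide)

lemma avg_words_take:
  assumes "k > 0" "m \<le> n"
  shows "avg_words k n (\<lambda>w. f (take m w)) = avg_words k m f"
proof -
  have "avg_words k (m + (n - m)) (\<lambda>w. f (take m w)) = avg_words k m f"
    unfolding avg_words_append
    by (rule avg_words_cong) (use assms(1) in \<open>simp add: words_def\<close>)
  then show ?thesis using assms(2) by simp
qed

lemma expected_LCS_eq:
  assumes "k > 0"
  shows "expected_LCS k n m = avg_words k n (\<lambda>w. avg_words k m (\<lambda>u. real (LCS w u)))"
proof -
  have ne: "words k n \<noteq> {}" for n
    using card_words[of k n] assms by (metis card.empty power_eq_0_iff less_irrefl)
  have "expected_LCS k n m =
      measure_pmf.expectation (pmf_of_set (words k n \<times> words k m)) (\<lambda>(w, w'). real (LCS w w'))"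
  proof -
    have "pair_pmf (pmf_of_set (words k n)) (pmf_of_set (words k m)) = pmf_of_set (words k n \<times> words k m)"
      by (rule pmf_eqI) (use ne in \<open>auto simp: pmf_pair card_cartesian_product indicator_def\<close>)
    then show ?thesis by (simp only: expected_LCS_def)
  qed
  also have "\<dots> = (\<Sum>(w, w')\<in>words k n \<times> words k m. real (LCS w w')) / card (words k n \<times> words k m)"
    by (subst integral_pmf_of_set) (use ne in auto)
  finally show ?thesis
    by (simp add: avg_words_def card_words card_cartesian_product sum.cartesian_product[symmetric]
        sum_divide_distrib field_simps)
qed

section \<open>Existence of the limit\<close>

text \<open>The limit is the supremum \<open>S\<close> of the ratios, finite by the linear bound.
  For \<open>d\<close> with ratio near \<open>S\<close>, packing \<open>n div d\<close> copies of
  \<open>d\<close> into \<open>n\<close> loses less than one copy.\<close>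

lemma fekete_superadditive:
  fixes a :: "nat \<Rightarrow> real"
  assumes super: "\<And>m n. a m + a n \<le> a (m + n)"
    and nonneg: "\<And>n. 0 \<le> a n" and bound: "\<And>n. a n \<le> C * real n"
  shows "convergent (\<lambda>n. a n / real n)"
proof -
  define S where "S = (SUP d\<in>{1..}. a d / real d)"
  have bdd: "bdd_above ((\<lambda>d. a d / real d) ` {1..})"
  proof (rule bdd_aboveI2)
    fix d :: nat assume "d \<in> {1..}"
    then show "a d / real d \<le> C" using bound[of d] by (simp add: field_simps)
  qed
  have le: "a d / real d \<le> S" if "d \<ge> 1" for d
    unfolding S_def by (rule cSUP_upper[OF _ bdd]) (use that in simp)
  have mult: "real q * a d \<le> a (q * d)" for q d
  proof (induction q)
    case (Suc q) then show ?case using super[of d "q * d"] by (simp add: algebra_simps)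
  qed (use nonneg in simp)
  have "(\<lambda>n. a n / real n) \<longlonglongrightarrow> S"
  proof (rule order_tendstoI)
    fix y assume "S < y"
    then show "\<forall>\<^sub>F n in sequentially. a n / real n < y"
      using le by (intro eventually_sequentiallyI[of 1]) (meson le_less_trans)
  next
    fix y assume "y < S"
    then obtain d where d: "d \<ge> 1" "y < a d / real d"
      unfolding S_def using less_cSUP_iff[OF _ bdd] by auto
    \<comment> \<open>Comparison sequence from below: the discarded remainder costs at most
      \<open>a d / n\<close>.\<close>
    have lim: "(\<lambda>n. a d / real d - a d / real n) \<longlonglongrightarrow> a d / real d - 0"
      by (intro tendsto_intros lim_const_over_n)
    have "\<forall>\<^sub>F n in sequentially. y < a d / real d - a d / real n"
      using order_tendstoD(1)[OF lim] d by simp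
    then show "\<forall>\<^sub>F n in sequentially. y < a n / real n"
      using eventually_gt_at_top[of 0]
    proof eventually_elim
      case (elim n)
      have "real n - real d \<le> real (n div d) * real d"
        using d mod_less_divisor[of d n] div_mult_mod_eq[of n d]
        by (smt (verit) le_eq_less_or_eq of_nat_add of_nat_le_iff of_nat_mult not_one_le_zero not_gr_zero)
      then have "(real n - real d) * a d \<le> real (n div d) * real d * a d"
        using nonneg by (intro mult_right_mono) auto
      also have "\<dots> \<le> real d * a (n div d * d)"
        using mult[of "n div d" d] d by (simp add: mult_ac)
      also have "a (n div d * d) \<le> a n"
        using super[of "n div d * d" "n mod d"] nonneg[of "n mod d"] by simp
      finally have "(real n - real d) * a d \<le> real d * a n" using d by simp
      then have "a d / real d - a d / real n \<le> a n / real n"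
        using d elim(2) by (simp add: divide_simps) (simp add: algebra_simps)
      then show ?case using elim by simp
    qed
  qed
  then show ?thesis by (rule convergentI)
qed

lemma expected_LCS_le: "k > 0 \<Longrightarrow> expected_LCS k n m \<le> real n"
proof -
  assume k: "k > 0"
  have "avg_words k n (\<lambda>w. avg_words k m (\<lambda>u. real (LCS w u))) \<le>
        avg_words k n (\<lambda>w. avg_words k m (\<lambda>u. real n))"
    by (intro avg_words_mono) (use LCS_le_length in \<open>force simp: words_def\<close>)
  then show ?thesis using k by (simp add: expected_LCS_eq)
qed

text \<open>Independent pairs of word and text are concatenated; the slack in
  \<open>m + m' \<le> l\<close> accommodates rounded text lengths.\<close>

lemma expected_LCS_super:
  assumes "k > 0" "m + m' \<le> l"
  shows "expected_LCS k n m + expected_LCS k n' m' \<le> expected_LCS k (n + n') l"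
proof -
  \<comment> \<open>The innermost average runs over the surplus text letters, on which this sum does
    not depend.\<close>
  have "expected_LCS k n m + expected_LCS k n' m' =
    avg_words k n (\<lambda>w. avg_words k n' (\<lambda>w'. avg_words k m (\<lambda>u. avg_words k m' (\<lambda>u'.
      avg_words k (l - (m + m')) (\<lambda>u''. real (LCS w u) + real (LCS w' u'))))))"
    using assms(1) by (simp add: avg_words_add expected_LCS_eq)
  also have "\<dots> \<le> avg_words k n (\<lambda>w. avg_words k n' (\<lambda>w'. avg_words k m (\<lambda>u. avg_words k m' (\<lambda>u'.
      avg_words k (l - (m + m')) (\<lambda>u''. real (LCS (w @ w') ((u @ u') @ u'')))))))"
  proof (intro avg_words_mono)
    fix w w' u u' u''
    have "LCS w u + LCS w' u' \<le> LCS (w @ w') ((u @ u') @ u'')"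
      using LCS_append_ge[of w u w' u'] LCS_mono[of "w @ w'" "w @ w'" "u @ u'" "(u @ u') @ u''"]
      by (simp add: prefix_imp_subseq del: append_assoc)
    then show "real (LCS w u) + real (LCS w' u') \<le> real (LCS (w @ w') ((u @ u') @ u''))"
      by linarith
  qed
  also have "\<dots> = avg_words k (n + n') (\<lambda>w. avg_words k (m + m' + (l - (m + m'))) (\<lambda>u. real (LCS w u)))"
    by (simp add: avg_words_append)
  finally show ?thesis using assms by (simp add: expected_LCS_eq)
qed

lemma expected_LCS_nonneg: "k > 0 \<Longrightarrow> 0 \<le> expected_LCS k n m"
  unfolding expected_LCS_eq avg_words_def by (intro divide_nonneg_nonneg sum_nonneg) auto

text \<open>The rounded text lengths are superadditive in \<open>n\<close>, so Fekete applies; only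
  then does \<open>lim\<close> carry information.\<close>

lemma lcs_gamma_LIMSEQ:
  assumes "k > 0" "\<epsilon> < 1"
  shows "(\<lambda>n. expected_LCS k n (nat \<lfloor>(1 - \<epsilon>) * real k * real n\<rfloor>) / real n) \<longlonglongrightarrow> lcs_gamma k \<epsilon>"
  unfolding lcs_gamma_def
proof (rule convergent_LIMSEQ_iff[THEN iffD1], rule fekete_superadditive[where C = 1])
  fix m n :: nat
  let ?f = "\<lambda>n. nat \<lfloor>(1 - \<epsilon>) * real k * real n\<rfloor>"
  have "?f m + ?f n \<le> ?f (m + n)"
    using le_floor_add[of "(1 - \<epsilon>) * real k * real m" "(1 - \<epsilon>) * real k * real n"] assms
    by (simp add: distrib_left flip: nat_add_distrib)
  then show "expected_LCS k m (?f m) + expected_LCS k n (?f n) \<le> expected_LCS k (m + n) (?f (m + n))"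
    using assms(1) by (rule expected_LCS_super[rotated])
qed (use assms expected_LCS_le expected_LCS_nonneg in auto)

section \<open>Minimal texts and their generating function\<close>

text \<open>Deleting at most \<open>r\<close> letters turns \<open>w\<close> into a subsequence of
  \<open>u\<close>; the additive form avoids truncated subtraction.\<close>

definition nearly_embeds :: "nat \<Rightarrow> 'a list \<Rightarrow> 'a list \<Rightarrow> bool" where
  "nearly_embeds r w u \<longleftrightarrow> length w \<le> LCS w u + r"

text \<open>The values at time T_r of a random text, where T_r is the first time at which
  \<open>w\<close> is matched with \<open>r\<close> skips. The cut-off \<open>M\<close> keeps the
  set, and hence all sums, finite.\<close>

definition minimal_texts :: "nat \<Rightarrow> nat \<Rightarrow> nat list \<Rightarrow> nat \<Rightarrow> nat list set" where
  "minimal_texts k r w M = {u. set u \<subseteq> {1..k} \<and> length u \<le> M \<and> nearly_embeds r w u \<and>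
     (\<forall>v. strict_prefix v u \<longrightarrow> \<not> nearly_embeds r w v)}"

text \<open>The expectation of \<open>exp (- \<theta> T_r)\<close> on the event
  \<open>T_r \<le> M\<close>: a random text begins with \<open>u\<close> with probability
  \<open>1 / k ^ length u\<close>.\<close>

definition text_gf :: "nat \<Rightarrow> nat \<Rightarrow> nat list \<Rightarrow> nat \<Rightarrow> real \<Rightarrow> real" where
  "text_gf k r w M \<theta> = (\<Sum>u\<in>minimal_texts k r w M. (exp (- \<theta>) / real k) ^ length u)"

lemma nearly_embeds_prefix:
  assumes "nearly_embeds r w u" "prefix u v"
  shows "nearly_embeds r w v"
  using assms LCS_mono[of w w u v] by (auto simp: nearly_embeds_def prefix_imp_subseq)

text \<open>Cut a longest common subsequence at the border of \<open>w\<close> and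
  \<open>w'\<close>; \<open>r'\<close> is the number of letters it misses in
  \<open>w\<close>.\<close>

lemma nearly_embeds_append_split:
  assumes "nearly_embeds r (w @ w') u"
  obtains r' v v' where "r' \<le> r" "u = v @ v'" "nearly_embeds r' w v" "nearly_embeds (r - r') w' v'"
proof -
  obtain x where x: "subseq x (w @ w')" "subseq x u" "length x = LCS (w @ w') u"
    by (rule LCS_obtain)
  obtain y y' where y: "x = y @ y'" "subseq y w" "subseq y' w'"
    using x(1) by (rule subseq_appendE)
  obtain v v' where v: "u = v @ v'" "subseq y v" "subseq y' v'"
    using x(2) unfolding y(1) by (metis list_emb_appendD)
  have "length w + length w' \<le> length y + length y' + r"
    using assms x(3) y(1) by (simp add: nearly_embeds_def)
  moreover have "length y \<le> length w" "length y' \<le> length w'"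
    using y by (auto dest: list_emb_length)
  moreover have "length y \<le> LCS w v" "length y' \<le> LCS w' v'"
    using y v by (auto intro: LCS_ge)
  ultimately show ?thesis
    using v(1) by (intro that[of "length w - length y" v v']) (auto simp: nearly_embeds_def)
qed

lemma finite_minimal_texts [simp]: "finite (minimal_texts k r w M)"
  by (rule finite_subset[OF _ finite_lists_length_le[of "{1..k}" M]]) (auto simp: minimal_texts_def)

lemma minimal_prefix_exists:
  assumes "nearly_embeds r w u" "set u \<subseteq> {1..k}" "length u \<le> M"
  obtains v v' where "u = v @ v'" "v \<in> minimal_texts k r w M"
proof -
  obtain v where v: "prefix v u" "nearly_embeds r w v"
    and min: "\<And>v'. prefix v' u \<and> nearly_embeds r w v' \<Longrightarrow> length v \<le> length v'"
    using ex_has_least_nat[of "\<lambda>v. prefix v u \<and> nearly_embeds r w v" u length] assms(1) by auto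
  have "v \<in> minimal_texts k r w M"
    using v assms(2,3) min
    by (auto simp: minimal_texts_def dest: set_mono_prefix prefix_length_le)
      (metis leD prefix_length_less prefix_order.dual_order.strict_implies_order prefix_order.trans)
  then show ?thesis using v(1) that by (auto elim: prefixE)
qed

lemma minimal_texts_eqI:
  assumes "v \<in> minimal_texts k r w M" "v' \<in> minimal_texts k r w M" "v @ x = v' @ x'"
  shows "v = v'"
proof -
  have "prefix v v' \<or> prefix v' v"
    using assms(3) by (metis prefixI prefix_same_cases)
  then show ?thesis
    using assms(1,2) unfolding minimal_texts_def by (auto simp: strict_prefix_def)
qed

text \<open>Minimal texts are prefix-free, so each successful text of length \<open>M\<close>
  extends exactly one of them, and one of length \<open>l\<close> has \<open>k ^ (M - l)\<close>
  extensions.\<close>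

lemma minimal_texts_mass:
  assumes "k > 0"
  shows "(\<Sum>u\<in>minimal_texts k r w M. (1 / real k) ^ length u) =
    real (card {u \<in> words k M. nearly_embeds r w u}) / real k ^ M"
proof -
  let ?S = "\<lambda>u. (\<lambda>v. u @ v) ` words k (M - length u)"
  have len: "length u \<le> M" if "u \<in> minimal_texts k r w M" for u
    using that by (simp add: minimal_texts_def)
  have eq: "{u \<in> words k M. nearly_embeds r w u} = (\<Union>u\<in>minimal_texts k r w M. ?S u)"
  proof (intro equalityI subsetI)
    fix u assume u: "u \<in> {u \<in> words k M. nearly_embeds r w u}"
    then obtain v v' where "u = v @ v'" "v \<in> minimal_texts k r w M"
      using minimal_prefix_exists[of r w u k M] by (auto simp: words_def)
    moreover from this u have "v' \<in> words k (M - length v)"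
      by (auto simp: words_def)
    ultimately show "u \<in> (\<Union>u\<in>minimal_texts k r w M. ?S u)" by blast
  next
    fix u assume "u \<in> (\<Union>u\<in>minimal_texts k r w M. ?S u)"
    then show "u \<in> {u \<in> words k M. nearly_embeds r w u}"
      unfolding words_def minimal_texts_def by (fastforce intro: nearly_embeds_prefix)
  qed
  have "card {u \<in> words k M. nearly_embeds r w u} = (\<Sum>u\<in>minimal_texts k r w M. card (?S u))"
    unfolding eq by (rule card_UN_disjoint) (auto dest: minimal_texts_eqI)
  also have "\<dots> = (\<Sum>u\<in>minimal_texts k r w M. k ^ (M - length u))"
    by (simp add: card_image inj_on_def card_words)
  finally have "real (card {u \<in> words k M. nearly_embeds r w u}) / real k ^ M =
      (\<Sum>u\<in>minimal_texts k r w M. real k ^ (M - length u) / real k ^ M)"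
    by (simp add: sum_divide_distrib)
  also have "\<dots> = (\<Sum>u\<in>minimal_texts k r w M. (1 / real k) ^ length u)"
    using assms len by (intro sum.cong) (auto simp: power_diff power_one_over field_simps)
  finally show ?thesis by simp
qed

lemma minimal_texts_mass_le_1:
  assumes "k > 0"
  shows "(\<Sum>u\<in>minimal_texts k r w M. (1 / real k) ^ length u) \<le> 1"
proof -
  have "card {u \<in> words k M. nearly_embeds r w u} \<le> card (words k M)"
    by (intro card_mono) auto
  then have "real (card {u \<in> words k M. nearly_embeds r w u}) \<le> real k ^ M"
    by (metis card_words of_nat_le_iff of_nat_power)
  then show ?thesis using assms by (simp add: minimal_texts_mass)
qed

lemma text_gf_nonneg: "0 \<le> text_gf k r w M \<theta>"
  unfolding text_gf_def by (intro sum_nonneg) auto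

text \<open>A minimal text for \<open>w @ w'\<close> splits into a minimal text for \<open>w\<close>
  with \<open>r'\<close> skips and one for \<open>w'\<close> with the rest; weights multiply because
  lengths add.\<close>

lemma text_gf_append:
  "text_gf k r (w @ w') M \<theta> \<le> (\<Sum>r'\<le>r. text_gf k r' w M \<theta> * text_gf k (r - r') w' M \<theta>)"
proof -
  let ?x = "exp (- \<theta>) / real k"
  let ?P = "\<lambda>r'. minimal_texts k r' w M \<times> minimal_texts k (r - r') w' M"
  let ?f = "\<lambda>(r' :: nat, u, v). u @ v :: nat list"
  have sub: "minimal_texts k r (w @ w') M \<subseteq> ?f ` (SIGMA r':{..r}. ?P r')"
  proof
    fix u assume u: "u \<in> minimal_texts k r (w @ w') M"
    then obtain r' v v' where v: "r' \<le> r" "u = v @ v'" "nearly_embeds r' w v" "nearly_embeds (r - r') w' v'"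
      unfolding minimal_texts_def by (blast elim: nearly_embeds_append_split)
    have su: "set u \<subseteq> {1..k}" "length u \<le> M" using u by (auto simp: minimal_texts_def)
    obtain v1 v2 where v1: "v = v1 @ v2" "v1 \<in> minimal_texts k r' w M"
      using minimal_prefix_exists[of r' w v k M] v su by auto
    \<comment> \<open>Text letters left over after the minimal prefix \<open>v1\<close> are handed
      to \<open>w'\<close>.\<close>
    have "nearly_embeds (r - r') w' (v2 @ v')"
      using v(4) LCS_mono[of w' w' v' "v2 @ v'"] 
      by (simp add: nearly_embeds_def list_emb_append2)
    then obtain v3 v4 where v3: "v2 @ v' = v3 @ v4" "v3 \<in> minimal_texts k (r - r') w' M"
      using minimal_prefix_exists[of "r - r'" w' "v2 @ v'" k M] v v1 su by auto
    have "LCS w v1 + LCS w' v3 \<le> LCS (w @ w') (v1 @ v3)" by (rule LCS_append_ge)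
    then have "nearly_embeds r (w @ w') (v1 @ v3)"
      using v1(2) v3(2) v(1) by (auto simp: minimal_texts_def nearly_embeds_def)
    moreover have "prefix (v1 @ v3) u" using v v1 v3 by auto
    ultimately have "u = v1 @ v3"
      using u by (auto simp: minimal_texts_def strict_prefix_def)
    then show "u \<in> ?f ` (SIGMA r':{..r}. ?P r')"
      using v(1) v1(2) v3(2) by (intro image_eqI[of _ _ "(r', v1, v3)"]) auto
  qed
  have "text_gf k r (w @ w') M \<theta> \<le> (\<Sum>u\<in>?f ` (SIGMA r':{..r}. ?P r'). ?x ^ length u)"
    unfolding text_gf_def by (intro sum_mono2 sub) auto
  \<comment> \<open>Several triples may yield the same text, hence only an inequality.\<close>
  also have "\<dots> \<le> sum ((\<lambda>u. ?x ^ length u) \<circ> ?f) (SIGMA r':{..r}. ?P r')"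
    by (intro sum_image_le) auto
  also have "\<dots> = (\<Sum>r'\<le>r. \<Sum>(u, v)\<in>?P r'. ?x ^ length u * ?x ^ length v)"
    by (subst sum.Sigma) (auto intro!: sum.cong simp: power_add)
  also have "\<dots> = (\<Sum>r'\<le>r. text_gf k r' w M \<theta> * text_gf k (r - r') w' M \<theta>)"
    unfolding text_gf_def sum_product sum.cartesian_product by simp
  finally show ?thesis .
qed

text \<open>Cauchy-Schwarz for the weights \<open>1 / k ^ length u\<close>, whose total is at most
  one.\<close>

lemma text_gf_square_le:
  assumes "k > 0"
  shows "(text_gf k r w M \<theta>)\<^sup>2 \<le> text_gf k r w M (2 * \<theta>)"
proof -
  let ?S = "minimal_texts k r w M"
  let ?p = "\<lambda>u. (1 / real k) ^ length u" and ?e = "\<lambda>u. exp (- \<theta>) ^ length (u :: nat list)"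
  have "(text_gf k r w M \<theta>)\<^sup>2 = (\<Sum>u\<in>?S. (sqrt (?p u) * ?e u) * sqrt (?p u))\<^sup>2"
    unfolding text_gf_def by (intro arg_cong[where f = "\<lambda>x. x\<^sup>2"] sum.cong)
      (simp_all add: power_divide field_simps)
  also have "\<dots> \<le> (\<Sum>u\<in>?S. (sqrt (?p u) * ?e u)\<^sup>2) * (\<Sum>u\<in>?S. (sqrt (?p u))\<^sup>2)"
    by (rule Cauchy_Schwarz_ineq_sum)
  also have "(\<Sum>u\<in>?S. (sqrt (?p u))\<^sup>2) = (\<Sum>u\<in>?S. ?p u)" by simp
  also have "(\<Sum>u\<in>?S. (sqrt (?p u) * ?e u)\<^sup>2) * (\<Sum>u\<in>?S. ?p u) \<le> (\<Sum>u\<in>?S. (sqrt (?p u) * ?e u)\<^sup>2) * 1"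
    using assms by (intro mult_left_mono minimal_texts_mass_le_1 sum_nonneg) auto
  also have "\<dots> = text_gf k r w M (2 * \<theta>)"
  proof -
    have "exp (- (2 * \<theta>)) = (exp (- \<theta>))\<^sup>2" by (simp flip: exp_of_nat_mult)
    then show ?thesis
      unfolding text_gf_def by (auto simp: power_mult_distrib power_divide power_mult[symmetric] mult.commute intro!: sum.cong)
  qed
  finally show ?thesis .
qed

text \<open>Chernoff bound: \<open>exp (\<theta> * (m - length u)) \<ge> 1\<close> for every text
  counted.\<close>

lemma prob_nearly_embeds_le:
  assumes "k > 0" "\<theta> \<ge> 0"
  shows "real (card {u \<in> words k m. nearly_embeds r w u}) / real k ^ m \<le> exp (\<theta> * real m) * text_gf k r w m \<theta>"
proof -
  have "(\<Sum>u\<in>minimal_texts k r w m. (1 / real k) ^ length u) \<le>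
      (\<Sum>u\<in>minimal_texts k r w m. exp (\<theta> * real m) * (exp (- \<theta>) / real k) ^ length u)"
  proof (rule sum_mono)
    fix u assume "u \<in> minimal_texts k r w m"
    then have "length u \<le> m" by (simp add: minimal_texts_def)
    then have "1 \<le> exp (\<theta> * real m - \<theta> * real (length u))"
      using assms by (simp add: mult_left_mono)
    also have "\<dots> = exp (\<theta> * real m) * exp (- \<theta>) ^ length u"
      by (simp add: exp_diff exp_minus power_inverse exp_of_nat2_mult field_simps)
    finally have "(1 / real k) ^ length u * 1 \<le> (1 / real k) ^ length u * (exp (\<theta> * real m) * exp (- \<theta>) ^ length u)"
      by (intro mult_left_mono) auto
    then show "(1 / real k) ^ length u \<le> exp (\<theta> * real m) * (exp (- \<theta>) / real k) ^ length u"
      by (simp add: power_divide mult_ac)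
  qed
  then show ?thesis
    using assms by (simp add: minimal_texts_mass text_gf_def sum_distrib_left)
qed

section \<open>Generating functions of single letters\<close>

lemma nearly_embeds_single_0: "nearly_embeds 0 [a] u \<longleftrightarrow> a \<in> set u"
proof
  assume "nearly_embeds 0 [a] u"
  obtain x where x: "subseq x [a]" "subseq x u" "length x = LCS [a] u"
    by (rule LCS_obtain)
  then have "x = [a]"
    using \<open>nearly_embeds 0 [a] u\<close> list_emb_length[OF x(1)]
    by (intro subseq_same_length) (simp_all add: nearly_embeds_def)
  then show "a \<in> set u" using x by (simp add: subseq_singleton_left)
next
  assume "a \<in> set u"
  then have "length [a] \<le> LCS [a] u"
    by (intro LCS_ge) (simp_all add: subseq_singleton_left)
  then show "nearly_embeds 0 [a] u" by (simp add: nearly_embeds_def)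
qed

lemma minimal_texts_single_Suc:
  assumes "a \<in> {1..k}"
  shows "minimal_texts k 0 [a] (Suc M) \<subseteq>
    insert [a] ((\<lambda>(c, u). c # u) ` (({1..k} - {a}) \<times> minimal_texts k 0 [a] M))"
proof
  fix u assume u: "u \<in> minimal_texts k 0 [a] (Suc M)"
  then obtain c v where cv: "u = c # v"
    by (cases u) (auto simp: minimal_texts_def nearly_embeds_single_0)
  show "u \<in> insert [a] ((\<lambda>(c, u). c # u) ` (({1..k} - {a}) \<times> minimal_texts k 0 [a] M))"
  proof (cases "c = a")
    case True
    have "v = []"
    proof (rule ccontr)
      assume "v \<noteq> []"
      then have "strict_prefix [a] u" using cv True by (cases v) auto
      then show False using u by (auto simp: minimal_texts_def nearly_embeds_single_0)
    qed
    then show ?thesis using cv True by simp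
  next
    case False
    have "v \<in> minimal_texts k 0 [a] M"
      using u cv False unfolding minimal_texts_def nearly_embeds_single_0
      by (auto simp: strict_prefix_def) (metis list.set_intros(2) Cons_prefix_Cons list.inject)
    moreover have "c \<in> {1..k}" using u cv by (auto simp: minimal_texts_def)
    ultimately show ?thesis using cv False by auto
  qed
qed

text \<open>The waiting time for one letter is geometric with success probability
  \<open>1/k\<close>; induction on the cut-off compares with its full transform
  \<open>z\<close>.\<close>

lemma text_gf_single_0:
  assumes "a \<in> {1..k}" "\<theta> > 0"
  shows "text_gf k 0 [a] M \<theta> \<le> 1 / (1 + real k * \<theta>)"
proof -
  let ?x = "exp (- \<theta>) / real k"
  have k: "k \<ge> 1" using assms by auto
  have x0: "0 < ?x" using k by simp
  \<comment> \<open>The solution of the one-step recursion \<open>z = x + (k - 1) * x * z\<close>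
    with \<open>x = exp (- \<theta>) / k\<close>.\<close>
  define z where "z = 1 / (1 + real k * (exp \<theta> - 1))"
  have den: "1 + real k * (exp \<theta> - 1) > 0"
    using k assms by (intro add_pos_nonneg) auto
  have z: "?x * (1 + (real k - 1) * z) = z"
  proof -
    have "1 + (real k - 1) * z = real k * exp \<theta> * z"
      using den unfolding z_def by (simp add: field_simps)
    then have "?x * (1 + (real k - 1) * z) = exp (- \<theta>) * exp \<theta> * z" using k by simp
    then show ?thesis by (simp flip: exp_add)
  qed
  have "text_gf k 0 [a] M \<theta> \<le> z"
  proof (induction M)
    case 0
    have "minimal_texts k 0 [a] 0 = {}" by (auto simp: minimal_texts_def nearly_embeds_single_0)
    then show ?case using den by (simp add: text_gf_def z_def)
  next
    case (Suc M)
    let ?A = "(\<lambda>(c, u). c # u) ` (({1..k} - {a}) \<times> minimal_texts k 0 [a] M)"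
    have "text_gf k 0 [a] (Suc M) \<theta> \<le> (\<Sum>u\<in>insert [a] ?A. ?x ^ length u)"
      unfolding text_gf_def using x0 by (intro sum_mono2 minimal_texts_single_Suc assms) auto
    also have "\<dots> \<le> ?x + (\<Sum>u\<in>?A. ?x ^ length u)"
      using x0 by (subst sum.insert_if) auto
    also have "(\<Sum>u\<in>?A. ?x ^ length u) = (\<Sum>c\<in>{1..k} - {a}. \<Sum>u\<in>minimal_texts k 0 [a] M. ?x * ?x ^ length u)"
    proof (subst sum.reindex)
      show "inj_on (\<lambda>(c, u). c # u) (({1..k} - {a}) \<times> minimal_texts k 0 [a] M)"
        by (auto simp: inj_on_def)
      show "(\<Sum>u\<in>({1..k} - {a}) \<times> minimal_texts k 0 [a] M. ((\<lambda>u. ?x ^ length u) \<circ> (\<lambda>(c, u). c # u)) u) =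
          (\<Sum>c\<in>{1..k} - {a}. \<Sum>u\<in>minimal_texts k 0 [a] M. ?x * ?x ^ length u)"
        unfolding sum.cartesian_product by (intro sum.cong) auto
    qed
    also have "\<dots> = (real k - 1) * (?x * text_gf k 0 [a] M \<theta>)"
      using assms k by (simp add: text_gf_def sum_distrib_left of_nat_diff)
    also have "\<dots> \<le> (real k - 1) * (?x * z)"
      using Suc k x0 by (intro mult_left_mono) auto
    also have "?x + (real k - 1) * (?x * z) = z" using z by (simp only: distrib_left mult_ac mult_1_right)
    finally show ?case by simp
  qed
  also have "z \<le> 1 / (1 + real k * \<theta>)"
  proof -
    have "real k * \<theta> \<le> real k * (exp \<theta> - 1)"
      using exp_ge_add_one_self[of \<theta>] by (intro mult_left_mono) (auto simp del: exp_ge_add_one_self)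
    then show ?thesis
      unfolding z_def using den k assms by (intro divide_left_mono mult_pos_pos) (auto intro: add_pos_nonneg)
  qed
  finally show ?thesis .
qed

text \<open>The only letter is skipped, so the empty text is already minimal.\<close>

lemma text_gf_single_Suc: "text_gf k (Suc r) [a] M \<theta> \<le> 1"
proof -
  have "minimal_texts k (Suc r) [a] M \<subseteq> {[]}"
  proof
    fix u assume "u \<in> minimal_texts k (Suc r) [a] M"
    moreover have "nearly_embeds (Suc r) [a] []" by (simp add: nearly_embeds_def)
    ultimately show "u \<in> {[]}" by (cases u) (auto simp: minimal_texts_def)
  qed
  then have "text_gf k (Suc r) [a] M \<theta> \<le> (\<Sum>u\<in>{[]}. (exp (- \<theta>) / real k) ^ length (u :: nat list))"
    unfolding text_gf_def by (intro sum_mono2) auto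
  then show ?thesis by simp
qed

section \<open>The upper bound\<close>

lemma one_over_one_plus_le:
  fixes z :: real
  assumes "z \<ge> 0"
  shows "1 / (1 + z) \<le> 1 - z + z\<^sup>2"
proof -
  \<comment> \<open>The product is \<open>1 + z ^ 3\<close>.\<close>
  have "1 \<le> (1 - z + z\<^sup>2) * (1 + z)"
    using zero_le_power[OF assms, of 3] by (simp add: algebra_simps power2_eq_square power3_eq_cube)
  then show ?thesis using assms by (subst divide_le_eq) auto
qed

lemma text_gf_Nil: "text_gf k r [] M \<theta> \<le> 1"
proof -
  have "minimal_texts k r [] M \<subseteq> {[]}"
  proof
    fix u assume "u \<in> minimal_texts k r [] M"
    moreover have "nearly_embeds r [] ([] :: nat list)" by (simp add: nearly_embeds_def)
    ultimately show "u \<in> {[]}" by (cases u) (auto simp: minimal_texts_def)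
  qed
  then have "text_gf k r [] M \<theta> \<le> (\<Sum>u\<in>{[]}. (exp (- \<theta>) / real k) ^ length (u :: nat list))"
    unfolding text_gf_def by (intro sum_mono2) auto
  then show ?thesis by simp
qed

text \<open>Without skips the letters are awaited one after another, so the single-letter bounds
  multiply.\<close>

lemma text_gf_0_le:
  assumes "set w \<subseteq> {1..k}" "\<theta> > 0"
  shows "text_gf k 0 w M \<theta> \<le> exp ((- (real k * \<theta>) + (real k * \<theta>)\<^sup>2) * real (length w))"
  using assms(1)
proof (induction w)
  case Nil
  then show ?case using text_gf_Nil by simp
next
  case (Cons a w)
  let ?x = "real k * \<theta>"
  have x: "?x \<ge> 0" using assms by simp
  have "1 / (1 + ?x) \<le> 1 + (- ?x + ?x\<^sup>2)"
    using one_over_one_plus_le[OF x] by simp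
  also have "\<dots> \<le> exp (- ?x + ?x\<^sup>2)" by (rule exp_ge_add_one_self)
  finally have single: "text_gf k 0 [a] M \<theta> \<le> exp (- ?x + ?x\<^sup>2)"
    using text_gf_single_0[of a k \<theta> M] Cons.prems assms(2) by auto
  have "text_gf k 0 ([a] @ w) M \<theta> \<le> text_gf k 0 [a] M \<theta> * text_gf k 0 w M \<theta>"
    using text_gf_append[of k 0 "[a]" w M \<theta>] by simp
  also have "\<dots> \<le> exp (- ?x + ?x\<^sup>2) * exp ((- ?x + ?x\<^sup>2) * real (length w))"
    using Cons single by (intro mult_mono text_gf_nonneg) auto
  finally show ?case by (simp add: algebra_simps flip: exp_add)
qed

text \<open>There are \<open>r + 1 \<le> 2 ^ r\<close> ways to distribute the skips, which doubles
  the base.\<close>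

lemma text_gf_append_geometric:
  assumes "\<And>r. text_gf k r w M \<theta> \<le> c * b ^ r" "\<And>r. text_gf k r w' M \<theta> \<le> c' * b ^ r"
    and "b \<ge> 0" "c \<ge> 0" "c' \<ge> 0"
  shows "text_gf k r (w @ w') M \<theta> \<le> c * c' * (2 * b) ^ r"
proof -
  have "text_gf k r (w @ w') M \<theta> \<le> (\<Sum>r'\<le>r. text_gf k r' w M \<theta> * text_gf k (r - r') w' M \<theta>)"
    by (rule text_gf_append)
  also have "\<dots> \<le> (\<Sum>r'\<le>r. (c * b ^ r') * (c' * b ^ (r - r')))"
    using assms by (intro sum_mono mult_mono text_gf_nonneg) auto
  also have "\<dots> = (\<Sum>r'\<le>r. c * c' * b ^ r)"
    by (intro sum.cong) (auto simp: mult_ac simp flip: power_add)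
  also have "\<dots> = real (r + 1) * (c * c' * b ^ r)" by simp
  also have "\<dots> \<le> 2 ^ r * (c * c' * b ^ r)"
  proof (intro mult_right_mono)
    have "r + 1 \<le> 2 ^ r" using less_exp[of r] by linarith
    then show "real (r + 1) \<le> 2 ^ r" by (metis of_nat_le_iff of_nat_numeral of_nat_power)
  qed (use assms in auto)
  finally show ?thesis by (simp add: power_mult_distrib mult_ac)
qed

text \<open>Quadrupling the length while halving \<open>\<theta>\<close> keeps the bound: by Cauchy--Schwarz the generating
  function at \<open>\<theta>\<close> is at most the square root of the one at \<open>2\<theta>\<close>, which absorbs the number of ways
  to distribute the skipped letters over the four quarters.\<close>

lemma text_gf_block:
  assumes "k > 0" "set w \<subseteq> {1..k}" "length w = 4 ^ s"
  shows "text_gf k r w M (1 / (2 * real k * 2 ^ s)) \<le> exp (1/4 - 2 ^ s / 2) * (4 * exp (1/2)) ^ r"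
  using assms(2,3)
proof (induction s arbitrary: w r)
  case 0
  then obtain a where a: "w = [a]" by (auto simp: length_Suc_conv)
  show ?case
  proof (cases r)
    case 0
    have "text_gf k 0 w M (1 / (2 * real k * 2 ^ 0)) \<le> exp (1/4 - 1/2)"
      using text_gf_0_le[of w k "1 / (2 * real k)" M] assms(1) "0.prems"
      by (simp add: power2_eq_square)
    then show ?thesis using 0 by simp
  next
    case (Suc r')
    \<comment> \<open>With a skip the generating function is at most one, and a single factor
      \<open>exp (1/2)\<close> lifts the claimed bound above one.\<close>
    have "1 \<le> exp (1/4 - 2 ^ 0 / 2) * exp (1/2 :: real)" by (simp flip: exp_add)
    also have "\<dots> \<le> exp (1/4 - 2 ^ 0 / 2) * (4 * exp (1/2 :: real)) ^ 1" by simp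
    also have "\<dots> \<le> exp (1/4 - 2 ^ 0 / 2) * (4 * exp (1/2 :: real)) ^ r"
    proof (intro mult_left_mono power_increasing)
      show "1 \<le> 4 * exp (1/2 :: real)" using one_le_exp_iff[of "1/2 :: real"] by linarith
    qed (use Suc in auto)
    finally show ?thesis
      using text_gf_single_Suc[of k r' a M "1 / (2 * real k * 2 ^ 0)"] a Suc by simp
  qed
next
  case (Suc s)
  show ?case
  \<comment> \<open>Four quarters give \<open>exp (1 - 2 ^ Suc s)\<close>, but the square of the
    claim has \<open>exp (1/2 - 2 ^ Suc s)\<close>. The missing \<open>exp (1/2)\<close> is paid by
    a skip; without skips the direct bound at \<open>k * \<theta> = 1 / (2 * 2 ^ Suc s)\<close> is
    exact enough.\<close>
  proof (cases "r = 0")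
    case True
    have "real k * (1 / (2 * real k * 2 ^ Suc s)) = 1 / 2 ^ Suc s / 2" using assms(1) by simp
    moreover have "(- (1 / 2 ^ Suc s / 2) + (1 / 2 ^ Suc s / 2)\<^sup>2) * real (4 ^ Suc s) = 1/4 - 2 ^ Suc s / (2 :: real)"
    proof -
      have "real (4 ^ Suc s) = 2 ^ Suc s * 2 ^ Suc s" by (simp flip: power_mult_distrib)
      then show ?thesis by (simp add: field_simps power2_eq_square)
    qed
    ultimately show ?thesis
      using text_gf_0_le[of w k "1 / (2 * real k * 2 ^ Suc s)" M] Suc.prems assms(1) True by simp
  next
    case False
    define \<theta> where "\<theta> = 1 / (2 * real k * 2 ^ Suc s)"
    have \<theta>: "1 / (2 * real k * 2 ^ s) = 2 * \<theta>" by (simp add: \<theta>_def)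
    define L where "L = (4 ^ s :: nat)"
    define c where "c = exp (1/4 - 2 ^ s / 2 :: real)"
    define b where "b = 4 * exp (1/2 :: real)"
    have b: "b \<ge> 0" and c: "c \<ge> 0" by (auto simp: b_def c_def)
    have quarter: "text_gf k r v M (2 * \<theta>) \<le> c * b ^ r" if "set v \<subseteq> set w" "length v = L" for v r
      using Suc.IH[of v r] that Suc.prems(1) by (simp add: \<theta> c_def b_def L_def)
    define w1 w2 w3 w4 where "w1 = take L w" and "w2 = take L (drop L w)"
      and "w3 = take L (drop (2 * L) w)" and "w4 = drop (3 * L) w"
    have len: "length w = 4 * L" using Suc.prems by (simp add: L_def)
    have w: "w = (w1 @ w2) @ (w3 @ w4)"
    proof -
      have "w = w1 @ drop L w" "drop L w = w2 @ drop (2 * L) w" "drop (2 * L) w = w3 @ w4"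
        using append_take_drop_id[of L "drop L w"] append_take_drop_id[of L "drop (2 * L) w"]
        by (simp_all add: w1_def w2_def w3_def w4_def flip: mult_2)
      then show ?thesis by simp
    qed
    have half: "text_gf k r (w1 @ w2) M (2 * \<theta>) \<le> c * c * (2 * b) ^ r"
         "text_gf k r (w3 @ w4) M (2 * \<theta>) \<le> c * c * (2 * b) ^ r" for r
      by (intro text_gf_append_geometric quarter b c;
          use len in \<open>force simp: w1_def w2_def w3_def w4_def dest: in_set_takeD in_set_dropD\<close>)+
    have "(text_gf k r w M \<theta>)\<^sup>2 \<le> text_gf k r w M (2 * \<theta>)"
      using assms(1) by (rule text_gf_square_le)
    also have "\<dots> \<le> c * c * (c * c) * (2 * (2 * b)) ^ r"
      unfolding w by (intro text_gf_append_geometric half) (use b c in auto)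
    also have "\<dots> = exp (1 - 2 ^ Suc s) * (4 ^ r * b ^ r)"
      by (simp add: c_def power_mult_distrib flip: exp_add)
    also have "\<dots> \<le> exp (1/2 - 2 ^ Suc s) * (b ^ r * b ^ r)"
    proof -
      \<comment> \<open>This explains \<open>b = 4 * exp (1/2)\<close>: 4 absorbs the two doublings
        of the base, \<open>exp (1/2)\<close> the missing constant.\<close>
      have "exp (1 / 2) \<le> exp (1 / 2 :: real) ^ r"
        using False power_increasing[of 1 r "exp (1 / 2 :: real)"] by simp
      then have "4 ^ r * exp (1 / 2) \<le> b ^ r"
        by (simp add: b_def power_mult_distrib)
      then have "exp (1/2 - 2 ^ Suc s) * ((4 ^ r * exp (1 / 2)) * b ^ r) \<le> exp (1/2 - 2 ^ Suc s) * (b ^ r * b ^ r)"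
        using b by (intro mult_left_mono mult_right_mono) auto
      moreover have "exp (1 - 2 ^ Suc s :: real) = exp (1/2 - 2 ^ Suc s) * exp (1/2)"
        by (simp flip: exp_add)
      ultimately show ?thesis by (simp add: mult_ac)
    qed
    also have "\<dots> = (exp (1/4 - 2 ^ Suc s / 2) * b ^ r)\<^sup>2"
      by (simp add: power_mult_distrib power2_eq_square flip: exp_add)
    finally have "text_gf k r w M \<theta> \<le> exp (1/4 - 2 ^ Suc s / 2) * b ^ r"
      by (rule power2_le_imp_le) (use b in auto)
    then show ?thesis by (simp add: \<theta>_def b_def)
  qed
qed

text \<open>Ratio of the geometric series over skips below; \<open>exp (7/2)\<close> is at least
  \<open>(3/2) ^ 7 > 12\<close>.\<close>

lemma exp_minus_seven_halves: "4 * exp (1/2) * exp (-4) \<le> (1/3 :: real)"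
proof -
  have "(1 + 7/2 / real 7) ^ 7 \<le> exp (7/2 :: real)"
    by (rule exp_ge_one_plus_x_over_n_power_n) auto
  then have "12 \<le> exp (7/2 :: real)" by (simp add: power_divide)
  then have "4 * inverse (exp (7/2)) \<le> 4 * inverse (12 :: real)"
    by (intro mult_left_mono le_imp_inverse_le) auto
  moreover have "exp (1/2) * exp (-4) = inverse (exp (7/2 :: real))"
    by (simp flip: exp_add exp_minus)
  ultimately show ?thesis by (simp add: mult.assoc)
qed

text \<open>Charging \<open>exp 4\<close> per skip makes the choice of how many fall into the first
  block a geometric series with ratio at most \<open>1/3\<close>. Its sum is below
  \<open>3/2 \<le> exp (1/2)\<close>, which turns \<open>1/4\<close> into \<open>3/4\<close> for
  each block.\<close>

lemma text_gf_blocks: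
  assumes "k > 0" "set w \<subseteq> {1..k}" "length w = N * 4 ^ s"
  shows "text_gf k r w M (1 / (2 * real k * 2 ^ s)) \<le> exp (4 * real r) * exp (3/4 - 2 ^ s / 2) ^ N"
  using assms(2,3)
proof (induction N arbitrary: w r)
  case 0
  have "1 \<le> exp (4 * real r)" by simp
  then show ?case
    using 0 text_gf_Nil[of k r M "1 / (2 * real k * 2 ^ s)"] by (simp del: one_le_exp_iff)
next
  case (Suc N)
  define \<theta> where "\<theta> = 1 / (2 * real k * 2 ^ s)"
  define v v' where "v = take (4 ^ s) w" and "v' = drop (4 ^ s) w"
  define G where "G = exp (3/4 - 2 ^ s / 2 :: real)"
  define c where "c = exp (1/4 - 2 ^ s / 2 :: real)"
  define q where "q = 4 * exp (1/2) * exp (-4 :: real)"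
  have 1: "text_gf k r v M \<theta> \<le> c * (4 * exp (1/2)) ^ r" for r
    unfolding \<theta>_def c_def using Suc.prems assms(1)
    by (intro text_gf_block) (auto simp: v_def dest: in_set_takeD)
  have 2: "text_gf k r v' M \<theta> \<le> exp (4 * real r) * G ^ N" for r
    unfolding \<theta>_def G_def using Suc.prems
    by (intro Suc.IH) (auto simp: v'_def dest: in_set_dropD)
  have "text_gf k r w M \<theta> \<le> (\<Sum>r'\<le>r. text_gf k r' v M \<theta> * text_gf k (r - r') v' M \<theta>)"
    using text_gf_append[of k r v v' M \<theta>] by (simp add: v_def v'_def)
  also have "\<dots> \<le> (\<Sum>r'\<le>r. (c * (4 * exp (1/2)) ^ r') * (exp (4 * real (r - r')) * G ^ N))"
    by (intro sum_mono mult_mono 1 2 text_gf_nonneg) (auto simp: c_def)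
  also have "\<dots> = (\<Sum>r'\<le>r. exp (4 * real r) * G ^ N * c * q ^ r')"
  proof (intro sum.cong refl)
    fix r' assume "r' \<in> {..r}"
    then have "exp (4 * real (r - r')) = exp (4 * real r) * exp (- 4) ^ r'"
      by (simp add: of_nat_diff algebra_simps flip: exp_of_nat_mult exp_add)
    then show "(c * (4 * exp (1/2)) ^ r') * (exp (4 * real (r - r')) * G ^ N) = exp (4 * real r) * G ^ N * c * q ^ r'"
      by (simp add: q_def power_mult_distrib mult_ac)
  qed
  also have "\<dots> = exp (4 * real r) * G ^ N * c * (\<Sum>r'\<le>r. q ^ r')"
    by (simp add: sum_distrib_left)
  also have "\<dots> \<le> exp (4 * real r) * G ^ N * c * exp (1/2)"
  proof (intro mult_left_mono)
    have "(\<Sum>r'\<le>r. q ^ r') \<le> (\<Sum>r'\<le>r. (1/3) ^ r')"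
      unfolding q_def by (intro sum_mono power_mono exp_minus_seven_halves) auto
    also have "\<dots> = 3/2 - (1/3) ^ r / (2 :: real)" by (induction r) auto
    also have "\<dots> \<le> 1 + 1/2" by simp
    also have "\<dots> \<le> exp (1/2 :: real)" by (rule exp_ge_add_one_self)
    finally show "(\<Sum>r'\<le>r. q ^ r') \<le> exp (1/2)" .
  qed (auto simp: G_def c_def)
  also have "\<dots> = exp (4 * real r) * G ^ Suc N"
    by (simp add: G_def c_def flip: exp_add)
  finally show ?case by (simp add: \<theta>_def G_def)
qed

text \<open>With \<open>r\<close> about \<open>\<epsilon>^2 n / 72\<close> skips, the Chernoff
  exponent is at most \<open>-1/36\<close> per block of length \<open>4 ^ s\<close>; on the
  exceptional event the trivial bound \<open>n\<close> is used.\<close>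

lemma expected_LCS_upper:
  fixes \<epsilon> :: real
  assumes k: "k > 0" and \<epsilon>: "0 < \<epsilon>" "\<epsilon> < 1"
    and s: "2 \<le> \<epsilon> * 2 ^ s" "\<epsilon> * 2 ^ s \<le> 4"
    and n: "n = N * 4 ^ s"
  shows "expected_LCS k n (nat \<lfloor>(1 - \<epsilon>) * real k * real n\<rfloor>) \<le>
    real n - \<epsilon>\<^sup>2 / 72 * real n + 1 + real n * exp (- 1/36) ^ N"
proof -
  define m where "m = nat \<lfloor>(1 - \<epsilon>) * real k * real n\<rfloor>"
  define r where "r = nat \<lfloor>\<epsilon>\<^sup>2 / 72 * real n\<rfloor>"
  define \<sigma> where "\<sigma> = \<epsilon> * 2 ^ s"
  define \<theta> where "\<theta> = 1 / (2 * real k * 2 ^ s)"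
  have m: "real m \<le> (1 - \<epsilon>) * real k * real n"
    unfolding m_def using \<epsilon> by (intro of_nat_floor) auto
  have r: "real r \<le> \<epsilon>\<^sup>2 / 72 * real n" "\<epsilon>\<^sup>2 / 72 * real n - 1 \<le> real r"
    unfolding r_def by (auto intro!: of_nat_floor) linarith
  have "\<epsilon>\<^sup>2 \<le> 1" using \<epsilon> by (simp add: power_le_one)
  then have "\<epsilon>\<^sup>2 / 72 * real n \<le> 1 * real n" by (intro mult_right_mono) auto
  then have rn: "real r \<le> real n" using r(1) by linarith
  have sq: "(4 :: real) ^ s = 2 ^ s * 2 ^ s" by (simp flip: power_mult_distrib)
  have expo: "\<theta> * real m + 4 * real r + (3/4 - 2 ^ s / 2) * real N \<le> - 1/36 * real N"
  proof -
    have "\<theta> * real m \<le> \<theta> * ((1 - \<epsilon>) * real k * real n)"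
      using m by (intro mult_left_mono) (auto simp: \<theta>_def)
    also have "\<dots> = (2 ^ s / 2 - \<sigma> / 2) * real N"
      using k by (simp add: \<theta>_def n \<sigma>_def sq field_simps)
    finally have 1: "\<theta> * real m \<le> (2 ^ s / 2 - \<sigma> / 2) * real N" .
    have 2: "4 * real r \<le> \<sigma>\<^sup>2 / 18 * real N"
      using r(1) by (simp add: n \<sigma>_def power_mult_distrib sq power2_eq_square mult_ac)
    \<comment> \<open>Convexity gives \<open>\<sigma>^2 \<le> 6 \<sigma> - 8\<close>, so the
      exponent is at most \<open>11/36 - \<sigma>/6\<close>, and
      \<open>\<sigma> \<ge> 2\<close>.\<close>
    have "(\<sigma> - 2) * (\<sigma> - 4) \<le> 0"
      using s by (intro mult_nonneg_nonpos) (auto simp: \<sigma>_def)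
    then have "- \<sigma> / 2 + \<sigma>\<^sup>2 / 18 + 3/4 \<le> - 1/36"
      using s(1) unfolding \<sigma>_def[symmetric] by (simp add: algebra_simps power2_eq_square)
    then have "(- \<sigma> / 2 + \<sigma>\<^sup>2 / 18 + 3/4) * real N \<le> - 1/36 * real N"
      by (intro mult_right_mono) auto
    then show ?thesis using 1 2 by (simp add: algebra_simps)
  qed
  have prob: "real (card {u \<in> words k m. nearly_embeds r w u}) / real k ^ m \<le> exp (- 1/36) ^ N"
    if w: "w \<in> words k n" for w
  proof -
    have "real (card {u \<in> words k m. nearly_embeds r w u}) / real k ^ m \<le> exp (\<theta> * real m) * text_gf k r w m \<theta>"
      using k by (intro prob_nearly_embeds_le) (auto simp: \<theta>_def)
    also have "\<dots> \<le> exp (\<theta> * real m) * (exp (4 * real r) * exp (3/4 - 2 ^ s / 2) ^ N)"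
      unfolding \<theta>_def using w k n
      by (intro mult_left_mono text_gf_blocks) (auto simp: words_def)
    also have "\<dots> = exp (\<theta> * real m + 4 * real r + (3/4 - 2 ^ s / 2) * real N)"
      by (simp add: exp_add exp_of_nat2_mult)
    also have "\<dots> \<le> exp (- 1/36 * real N)" using expo by simp
    also have "\<dots> = exp (- 1/36) ^ N" by (rule exp_of_nat2_mult)
    finally show ?thesis .
  qed
  have "expected_LCS k n m \<le> avg_words k n (\<lambda>w. avg_words k m (\<lambda>u. (real n - real r) + real n * of_bool (nearly_embeds r w u)))"
    unfolding expected_LCS_eq[OF k]
  proof (intro avg_words_mono)
    fix w u assume w: "w \<in> words k n"
    then show "real (LCS w u) \<le> (real n - real r) + real n * of_bool (nearly_embeds r w u)"
      using LCS_le_length[of w u] rn by (auto simp: words_def nearly_embeds_def)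
  qed
  also have "\<dots> = avg_words k n (\<lambda>w. (real n - real r) + real n * (real (card {u \<in> words k m. nearly_embeds r w u}) / real k ^ m))"
    using k by (simp only: avg_words_add avg_words_mult avg_words_const avg_words_of_bool)
  also have "\<dots> \<le> avg_words k n (\<lambda>w. (real n - real r) + real n * exp (- 1/36) ^ N)"
    by (intro avg_words_mono add_left_mono mult_left_mono prob) auto
  also have "\<dots> = (real n - real r) + real n * exp (- 1/36) ^ N" using k by simp
  finally show ?thesis using r(2) by (simp add: m_def)
qed

text \<open>Since the limit exists, it suffices to bound it along multiples of the block
  length.\<close>

lemma lcs_gamma_upper:
  fixes \<epsilon> :: real
  assumes k: "k > 0" and \<epsilon>: "0 < \<epsilon>" "\<epsilon> < 1"
  shows "lcs_gamma k \<epsilon> \<le> 1 - \<epsilon>\<^sup>2 / 72"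
proof -
  \<comment> \<open>The least such \<open>s\<close> overshoots 2 by at most a factor two.\<close>
  have "\<exists>s. 2 \<le> \<epsilon> * 2 ^ s"
    using real_arch_pow[of 2 "2 / \<epsilon>"] \<epsilon> by (auto simp: field_simps intro: less_imp_le)
  then obtain s where s: "2 \<le> \<epsilon> * 2 ^ s" and min: "\<And>s'. s' < s \<Longrightarrow> \<not> 2 \<le> \<epsilon> * 2 ^ s'"
    using exists_least_iff[of "\<lambda>s. 2 \<le> \<epsilon> * 2 ^ s"] by blast
  have s4: "\<epsilon> * 2 ^ s \<le> 4"
  proof (cases s)
    case (Suc s') then show ?thesis using min[of s'] by simp
  qed (use \<epsilon> in simp)
  let ?a = "\<lambda>n. expected_LCS k n (nat \<lfloor>(1 - \<epsilon>) * real k * real n\<rfloor>) / real n"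
  have "strict_mono (\<lambda>N :: nat. N * 4 ^ s)" by (auto intro!: strict_monoI)
  then have lim: "(\<lambda>N. ?a (N * 4 ^ s)) \<longlonglongrightarrow> lcs_gamma k \<epsilon>"
    using LIMSEQ_subseq_LIMSEQ[OF lcs_gamma_LIMSEQ[OF k \<epsilon>(2)]] 
    unfolding o_def by blast
  have lim': "(\<lambda>N. 1 - \<epsilon>\<^sup>2 / 72 + 1 / real N + exp (- 1/36) ^ N) \<longlonglongrightarrow> 1 - \<epsilon>\<^sup>2 / 72 + 0 + 0"
    by (intro tendsto_intros lim_const_over_n LIMSEQ_realpow_zero) auto
  have "\<exists>N0. \<forall>N\<ge>N0. ?a (N * 4 ^ s) \<le> 1 - \<epsilon>\<^sup>2 / 72 + 1 / real N + exp (- 1/36) ^ N"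
  proof (intro exI allI impI)
    fix N :: nat assume N: "1 \<le> N"
    define n where "n = N * 4 ^ s"
    have n: "real n > 0" "real N \<le> real n" using N by (auto simp: n_def)
    have "?a n \<le> (real n - \<epsilon>\<^sup>2 / 72 * real n + 1 + real n * exp (- 1/36) ^ N) / real n"
      using n by (intro divide_right_mono expected_LCS_upper[OF k \<epsilon> s s4 n_def]) auto
    also have "\<dots> = 1 - \<epsilon>\<^sup>2 / 72 + 1 / real n + exp (- 1/36) ^ N"
      using n by (simp add: field_simps)
    also have "\<dots> \<le> 1 - \<epsilon>\<^sup>2 / 72 + 1 / real N + exp (- 1/36) ^ N"
      using n N by (simp add: frac_le)
    finally show "?a (N * 4 ^ s) \<le> 1 - \<epsilon>\<^sup>2 / 72 + 1 / real N + exp (- 1/36) ^ N"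
      by (simp add: n_def)
  qed
  from LIMSEQ_le[OF lim lim' this] show ?thesis by simp
qed

section \<open>Matching with one skipped letter held in reserve\<close>

text \<open>The word \<open>z\<close> may extend beyond the goal \<open>n\<close>: matches lower
  \<open>n\<close>, while further random letters stay available to the strategy.\<close>

definition defect :: "nat \<Rightarrow> 'a list \<Rightarrow> 'a list \<Rightarrow> real" where
  "defect n z u = real n - real (LCS (take n z) u)"

text \<open>The second run stands \<open>H\<close> letters ahead and is charged only for its skip;
  \<open>min\<close> postpones the choice between the runs. Once \<open>H\<close> exceeds
  \<open>n\<close>, its remaining goal is 0 by truncated subtraction.\<close>

definition gap_defect :: "nat \<Rightarrow> nat \<Rightarrow> 'a list \<Rightarrow> 'a list \<Rightarrow> real" where
  "gap_defect n H z u = min (defect n z u) (1 + defect (n - H) (drop H z) u)"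

lemma LCS_Nil1 [simp]: "LCS [] u = 0"
  using LCS_le_length[of "[]" u] by simp

lemma defect_0 [simp]: "defect 0 z u = 0"
  by (simp add: defect_def)

lemma defect_Nil [simp]: "defect n z [] = real n"
  by (simp add: defect_def)

lemma defect_Cons_text: "defect n z (y # u) \<le> defect n z u"
  using LCS_mono[of "take n z" "take n z" u "y # u"] by (simp add: defect_def list_emb_Cons)

lemma defect_match: "defect n (y # z) (y # u) \<le> defect (n - 1) z u"
proof (cases n)
  case (Suc n')
  have "length [y] \<le> LCS [y] [y]" by (rule LCS_ge) auto
  then have "1 + LCS (take n' z) u \<le> LCS (y # take n' z) (y # u)"
    using LCS_append_ge[of "[y]" "[y]" "take n' z" u] by simp
  then show ?thesis using Suc by (simp add: defect_def)
qed simp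

lemma defect_skip: "defect n (x # z) u \<le> 1 + defect (n - 1) z u"
proof (cases n)
  case (Suc n')
  have "LCS (take n' z) u \<le> LCS (x # take n' z) u" by (rule LCS_mono) auto
  then show ?thesis using Suc by (simp add: defect_def)
qed simp

section \<open>Effect of one text letter on the pair of runs\<close>

lemma gap_defect_0: "gap_defect 0 H z u = 0"
  by (simp add: gap_defect_def)

lemma gap_defect_none: "gap_defect n H z (y # u) \<le> gap_defect n H z u"
  unfolding gap_defect_def by (intro min.mono add_left_mono defect_Cons_text)

lemma gap_defect_both:
  assumes "drop H (y # z) = y # drop H z"
  shows "gap_defect n H (y # z) (y # u) \<le> gap_defect (n - 1) H z u"
proof -
  have "n - H - 1 = n - 1 - H" by simp
  then show ?thesis
    using defect_match[of "n - H" y "drop H z" u] defect_match[of n y z u]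
    unfolding gap_defect_def assms by (auto intro: min.mono)
qed

lemma gap_defect_first:
  "gap_defect n (Suc H) (y # z) (y # u) \<le> gap_defect (n - 1) H z u"
  using defect_match[of n y z u] defect_Cons_text[of "n - Suc H" "drop H z" y u]
  unfolding gap_defect_def by (auto intro: min.mono)

text \<open>A skip takes the first run to where the second one stands, so at gap 1 the second run
  may be forgotten and restarted later. This is the reflection of the walk.\<close>

lemma gap_defect_1:
  assumes "z \<noteq> []"
  shows "gap_defect n 1 z u = defect n z u"
proof -
  obtain a z' where "z = a # z'" using assms by (cases z) auto
  then show ?thesis using defect_skip[of n a z' u] by (simp add: gap_defect_def)
qed

lemma gap_defect_second:
  assumes "drop H z = y # z'"
  shows "gap_defect n H z (y # u) \<le> gap_defect n (Suc H) z u"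
proof -
  have "drop (Suc H) z = z'" using assms by (metis drop_Suc list.sel(3) tl_drop)
  then show ?thesis
    using defect_match[of "n - H" y z' u] defect_Cons_text[of n z y u]
    unfolding gap_defect_def assms by (auto intro: min.mono)
qed

text \<open>The list \<open>s\<close> holds the letters of the word from the position of the run without a skip up to
  the next letter of the run that has skipped one letter; \<open>y\<close> is the next letter of the text and \<open>x\<close> a
  fresh letter of the word.  When the first run catches up, the second one skips the letter at which it stands.\<close>

definition needs_fresh :: "nat list \<Rightarrow> nat \<Rightarrow> bool" where
  "needs_fresh s y \<longleftrightarrow> y = last s \<or> y = hd s \<and> length s = 2"

text \<open>The gap is \<open>length s - 1\<close>. A fresh letter is revealed when the second run
  advances or when gap 1, closed by the first run, is reopened.\<close>

definition run_step :: "nat list \<Rightarrow> nat \<Rightarrow> nat \<Rightarrow> nat list" where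
  "run_step s y x = (if y = hd s then tl s else s) @ (if needs_fresh s y then [x] else [])"

lemma drop_length_Cons: "s \<noteq> [] \<Longrightarrow> drop (length s) (c # s @ v) = last s # v"
  by (induction s arbitrary: c) auto

lemma gap_defect_run_step:
  assumes "length s \<ge> 2"
  shows "gap_defect n (length s - 1) (s @ (if needs_fresh s y then [x] else []) @ w) (y # u) \<le>
    gap_defect (n - of_bool (y = hd s)) (length (run_step s y x) - 1) (run_step s y x @ w) u"
proof -
  obtain a s' where s: "s = a # s'" "s' \<noteq> []" using assms by (cases s) (auto simp: Suc_le_length_iff)
  \<comment> \<open>Both runs match; the first catches up from gap 1; it comes closer; only the
    second matches; neither does.\<close>
  consider "y = a" "y = last s'" | "y = a" "y \<noteq> last s'" "length s' = 1" | "y = a" "y \<noteq> last s'" "length s' > 1"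
    | "y \<noteq> a" "y = last s'" | "y \<noteq> a" "y \<noteq> last s'"
    using s by (cases "length s'") auto
  then show ?thesis
  proof cases
    case 1
    have "drop (length s') (y # s' @ x # w) = y # drop (length s') (s' @ x # w)"
      using 1 s by (simp add: drop_length_Cons)
    then show ?thesis
      using gap_defect_both[of "length s'" y "s' @ x # w" n u] 1 s
      by (simp add: run_step_def needs_fresh_def)
  next
    case 2
    \<comment> \<open>At gap 1 both sides are plain defects, so the skip moves on to the next
      letter.\<close>
    have "gap_defect n 1 (y # s' @ x # w) (y # u) \<le> gap_defect (n - 1) 1 (s' @ x # w) u"
      using defect_match[of n y "s' @ x # w" u] by (simp add: gap_defect_1 del: One_nat_def)
    then show ?thesis using 2 s by (simp add: run_step_def needs_fresh_def)
  next
    case 3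
    then show ?thesis
      using gap_defect_first[of n "length s' - 1" y "s' @ w" u] s
      by (simp add: run_step_def needs_fresh_def)
  next
    case 4
    have "drop (length s') (a # s' @ x # w) = y # x # w"
      using 4 s by (simp add: drop_length_Cons)
    then show ?thesis
      using gap_defect_second[of "length s'" "a # s' @ x # w" y "x # w" n u] 4 s
      by (simp add: run_step_def needs_fresh_def)
  next
    case 5
    then show ?thesis
      using gap_defect_none[of n "length s'" "a # s' @ w" y u] s
      by (simp add: run_step_def needs_fresh_def)
  qed
qed

lemma set_run_step:
  assumes "set s \<subseteq> A" "x \<in> A"
  shows "set (run_step s y x) \<subseteq> A"
proof
  fix c assume c: "c \<in> set (run_step s y x)"
  have "c \<in> set s \<or> c = x"
  proof (cases "needs_fresh s y"; cases "y = hd s")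
  qed (use c in \<open>cases s; auto simp: run_step_def\<close>)+
  then show "c \<in> A" using assms by blast
qed

lemma length_run_step_ge:
  assumes "2 \<le> length s"
  shows "2 \<le> length (run_step s y x)"
proof (cases "length s = 2")
  case False
  then show ?thesis using assms by (auto simp: run_step_def)
qed (simp add: run_step_def needs_fresh_def)

lemma length_run_step_le: "length (run_step s y x) \<le> Suc (length s)"
  by (auto simp: run_step_def)

section \<open>The potential\<close>

text \<open>The square of a symmetric walk grows linearly, so \<open>h^2 - gap^2\<close> measures
  the time left until the gap reaches \<open>h\<close>, where the walk is stopped. The indicator
  charges for frozen states.\<close>

definition potential :: "nat \<Rightarrow> nat list \<Rightarrow> real" where
  "potential h s = (if length s > h then 0
     else (real h)\<^sup>2 - (real (length s - 1))\<^sup>2 + of_bool (hd s = last s))"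

lemma sum_single_point:
  fixes c d :: real
  assumes "a \<in> {1..k}"
  shows "(\<Sum>y=1..k. if y = a then c else d) = c + (real k - 1) * d"
proof -
  have "(\<Sum>y=1..k. if y = a then c else d) = (\<Sum>y=1..k. (if y = a then c - d else 0) + d)"
    by (intro sum.cong) auto
  also have "\<dots> = c + (real k - 1) * d"
    using assms by (simp add: sum.distrib algebra_simps)
  finally show ?thesis .
qed

lemma sum_two_points:
  fixes c d e :: real
  assumes "a \<in> {1..k}" "b \<in> {1..k}" "a \<noteq> b"
  shows "(\<Sum>y=1..k. if y = a then c else if y = b then d else e) = c + d + (real k - 2) * e"
proof -
  have "(\<Sum>y=1..k. if y = a then c else if y = b then d else e) =
      (\<Sum>y=1..k. (if y = a then c - e else 0) + (if y = b then d - e else 0) + e)"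
    using assms(3) by (intro sum.cong) auto
  also have "\<dots> = c + d + (real k - 2) * e"
    using assms by (simp add: sum.distrib algebra_simps)
  finally show ?thesis .
qed

text \<open>At gap \<open>h\<close> the quadratic part vanishes, so the formula also bounds the
  stopped value.\<close>

lemma potential_le: "length s \<le> Suc h \<Longrightarrow>
    potential h s \<le> (real h)\<^sup>2 - (real (length s - 1))\<^sup>2 + of_bool (hd s = last s)"
  by (auto simp: potential_def power_mono not_less_eq le_Suc_eq)

lemma sum_potential_fresh_le:
  assumes "set s \<subseteq> {1..k}" "s \<noteq> []" "length s \<le> h"
  shows "(\<Sum>x=1..k. potential h (s @ [x])) \<le> real k * ((real h)\<^sup>2 - (real (length s))\<^sup>2) + 1"
proof -
  have "(\<Sum>x=1..k. potential h (s @ [x])) \<le>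
      (\<Sum>x=1..k. (if x = hd s then (real h)\<^sup>2 - (real (length s))\<^sup>2 + 1 else (real h)\<^sup>2 - (real (length s))\<^sup>2))"
    by (intro sum_mono order_trans[OF potential_le]) (use assms in auto)
  also have "\<dots> = real k * ((real h)\<^sup>2 - (real (length s))\<^sup>2) + 1"
    using assms hd_in_set[of s] by (subst sum_single_point) (auto simp: algebra_simps simp del: hd_in_set)
  finally show ?thesis .
qed

text \<open>The index gap performs a symmetric walk which is frozen while both runs wait for the same letter.
  After a step of the second run that happens with probability \<open>1/k\<close>; after a step of the first run it is
  assumed to happen always.\<close>

lemma potential_drift:
  assumes "k \<ge> 2" "set s \<subseteq> {1..k}" "2 \<le> length s" "length s \<le> h"
  shows "(\<Sum>y=1..k. \<Sum>x=1..k. potential h (run_step s y x)) / (real k)\<^sup>2 \<le>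
    (1 - (1 - 1 / real k) / (real k * (real h)\<^sup>2)) * potential h s"
proof -
  obtain a s' where s: "s = a # s'" "s' \<noteq> []" using assms by (cases s) (auto simp: Suc_le_length_iff)
  define H where "H = length s'"
  define q where "q = (\<lambda>i. (real h)\<^sup>2 - i\<^sup>2)"
  define b where "b = last s'"
  have H: "1 \<le> H" "H < h" using assms s by (auto simp: H_def Suc_le_eq)
  have ab: "a \<in> {1..k}" "b \<in> {1..k}" using assms s last_in_set[of s'] by (auto simp: b_def simp del: last_in_set)
  have s'k: "set s' \<subseteq> {1..k}" using assms s by auto
  have pot: "potential h s = q H + of_bool (a = b)"
    using assms s by (simp add: potential_def q_def H_def b_def)
  have fresh: "(\<Sum>x=1..k. potential h (s' @ [x])) \<le> real k * q H + 1"
    using sum_potential_fresh_le[of s' k h] s s'k H by (simp add: q_def H_def)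
  \<comment> \<open>Frozen: on a match the indicator drops from 1 to \<open>1/k\<close> on average.
    Otherwise the two moves contribute -2 from the squares and at most \<open>1 + 1/k\<close> from
    the indicators. Both drops equal \<open>1 - 1/k\<close>, with probability weight
    \<open>1/k\<close>.\<close>
  have step: "(\<Sum>y=1..k. \<Sum>x=1..k. potential h (run_step s y x)) \<le>
     (real k)\<^sup>2 * potential h s - (real k - 1)"
  proof (cases "a = b")
    case True
    have "(\<Sum>y=1..k. \<Sum>x=1..k. potential h (run_step s y x)) =
        (\<Sum>y=1..k. if y = a then (\<Sum>x=1..k. potential h (s' @ [x])) else real k * potential h s)"
      using True s by (intro sum.cong refl) (auto simp: run_step_def needs_fresh_def b_def)
    also have "\<dots> \<le> (real k * q H + 1) + (real k - 1) * (real k * potential h s)"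
      using fresh ab by (subst sum_single_point) auto
    also have "\<dots> = (real k)\<^sup>2 * potential h s - (real k - 1)"
      using True by (simp add: pot algebra_simps power2_eq_square)
    finally show ?thesis .
  next
    case False
    \<comment> \<open>At gap 1 the reflected walk keeps its gap, which is harmless since
      \<open>q 1 < q 0\<close>.\<close>
    have one: "(\<Sum>x=1..k. potential h (run_step s a x)) \<le> real k * (q (real H - 1) + 1)"
    proof (cases "H = 1")
      case True
      have "(\<Sum>x=1..k. potential h (run_step s a x)) = (\<Sum>x=1..k. potential h (s' @ [x]))"
        using True s by (intro sum.cong refl) (auto simp: run_step_def needs_fresh_def H_def)
      also have "\<dots> \<le> real k * q H + 1" by (rule fresh)
      also have "\<dots> \<le> real k * (q (real H - 1) + 1)"
        using True assms(1) by (simp add: q_def algebra_simps)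
      finally show ?thesis .
    next
      case H1: False
      have "run_step s a x = s'" for x
        using False H1 s H by (auto simp: run_step_def needs_fresh_def H_def b_def)
      moreover have "potential h s' \<le> q (real H - 1) + 1"
        using potential_le[of s' h] H s 
        by (cases "hd s' = last s'") (auto simp: q_def H_def of_nat_diff)
      ultimately show ?thesis by (simp add: mult_left_mono)
    qed
    have two: "(\<Sum>x=1..k. potential h (s @ [x])) \<le> real k * q (real H + 1) + 1"
      using sum_potential_fresh_le[of s k h] assms s by (simp add: q_def H_def add_ac)
    have "(\<Sum>y=1..k. \<Sum>x=1..k. potential h (run_step s y x)) =
        (\<Sum>y=1..k. if y = a then (\<Sum>x=1..k. potential h (run_step s a x))
          else if y = b then (\<Sum>x=1..k. potential h (s @ [x])) else real k * potential h s)"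
      using False s by (intro sum.cong refl) (auto simp: run_step_def needs_fresh_def b_def)
    also have "\<dots> \<le> real k * (q (real H - 1) + 1) + (real k * q (real H + 1) + 1) + (real k - 2) * (real k * potential h s)"
      using one two False ab by (subst sum_two_points) auto
    also have "\<dots> = (real k)\<^sup>2 * potential h s - (real k - 1)"
      using False by (simp add: pot q_def algebra_simps power2_eq_square)
    finally show ?thesis .
  qed
  \<comment> \<open>Turns the additive drift into a multiplicative one.\<close>
  have h2: "potential h s \<le> (real h)\<^sup>2"
  proof -
    have "1 \<le> (real H)\<^sup>2" using H by simp
    then show ?thesis by (simp add: pot q_def)
  qed
  have "(real k - 1) / (real k)\<^sup>2 * (potential h s / (real h)\<^sup>2) \<le> (real k - 1) / (real k)\<^sup>2 * 1"
    using h2 assms(1) H by (intro mult_left_mono) (auto simp: divide_le_eq)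
  moreover have "(1 - (1 - 1 / real k) / (real k * (real h)\<^sup>2)) * potential h s =
      potential h s - (real k - 1) / (real k)\<^sup>2 * (potential h s / (real h)\<^sup>2)"
    using assms(1) H by (simp add: field_simps power2_eq_square)
  moreover have "((real k)\<^sup>2 * potential h s - (real k - 1)) / (real k)\<^sup>2 = potential h s - (real k - 1) / (real k)\<^sup>2"
    using assms(1) by (simp add: field_simps)
  ultimately have "((real k)\<^sup>2 * potential h s - (real k - 1)) / (real k)\<^sup>2 \<le>
      (1 - (1 - 1 / real k) / (real k * (real h)\<^sup>2)) * potential h s" by linarith
  then show ?thesis using divide_right_mono[OF step, of "(real k)\<^sup>2"] by simp
qed

section \<open>Expected defects\<close>

lemma exp_minus_le:
  fixes z :: real
  assumes "z \<ge> 0"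
  shows "exp (- z) \<le> 1 - z + z\<^sup>2"
proof -
  have "exp (- z) \<le> 1 / (1 + z)"
    using assms exp_ge_add_one_self[of z] by (simp add: exp_minus field_simps)
  also have "\<dots> \<le> 1 - z + z\<^sup>2" using assms by (rule one_over_one_plus_le)
  finally show ?thesis .
qed

locale reserve_strategy =
  fixes k h :: nat and \<eta> :: real
  assumes k: "k \<ge> 2" and h: "h \<ge> 1" and \<eta>: "0 < \<eta>" "\<eta> \<le> 1"
begin

text \<open>Invariant for the last \<open>m\<close> text letters, to which earlier pieces are
  prepended: \<open>D\<close> counts skips paid, the exponential prices the \<open>n\<close> letters
  still to be matched. The awaited letter \<open>c\<close> is already known; the rest of the word is
  random.\<close>

definition defect_bound :: "real \<Rightarrow> real \<Rightarrow> nat \<Rightarrow> nat \<Rightarrow> bool" where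
  "defect_bound D A m W0 \<longleftrightarrow> (\<forall>c\<in>{1..k}. \<forall>n. \<forall>W\<ge>W0.
     avg_words k W (\<lambda>w. avg_words k m (\<lambda>u. defect n (c # w) u)) \<le> D + A * exp (\<eta> * real n))"

text \<open>Greedy matching alone: each text letter matches with probability \<open>1/k\<close> and
  then gains a factor \<open>exp (- \<eta>)\<close>.\<close>

lemma defect_bound_single_run:
  assumes base: "defect_bound D A m W0" and "D \<ge> 0" "A \<ge> 0"
  shows "defect_bound D (A * (1 - (1 - exp (- \<eta>)) / real k) ^ t) (t + m) (t + W0)"
proof (induction t)
  case 0
  then show ?case using base by simp
next
  case (Suc t)
  define \<rho> where "\<rho> = 1 - (1 - exp (- \<eta>)) / real k"
  have "\<rho> \<ge> 0"
  proof -
    have "(1 - exp (- \<eta>)) / real k \<le> 1" using k exp_gt_zero[of "- \<eta>"] by (simp add: divide_le_eq del: exp_gt_zero)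
    then show ?thesis by (simp add: \<rho>_def)
  qed
  define R where "R = A * \<rho> ^ t"
  have R: "R \<ge> 0" using \<open>\<rho> \<ge> 0\<close> assms by (simp add: R_def)
  have IH: "avg_words k W (\<lambda>w. avg_words k (t + m) (\<lambda>u. defect n (c # w) u)) \<le> D + R * exp (\<eta> * real n)"
    if "c \<in> {1..k}" "t + W0 \<le> W" for c n W
    using Suc.IH that unfolding defect_bound_def R_def \<rho>_def by blast
  show ?case
    unfolding defect_bound_def \<rho>_def[symmetric]
  proof (intro ballI allI impI)
    fix c n W assume c: "c \<in> {1..k}" and W: "Suc t + W0 \<le> W"
    then obtain W' where W': "W = Suc W'" "t + W0 \<le> W'" by (cases W) auto
    let ?I = "\<lambda>y. avg_words k W (\<lambda>w. avg_words k (t + m) (\<lambda>u. defect n (c # w) (y # u)))"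
    show "avg_words k W (\<lambda>w. avg_words k (Suc t + m) (\<lambda>u. defect n (c # w) u)) \<le>
        D + A * \<rho> ^ Suc t * exp (\<eta> * real n)"
    proof (cases "n = 0")
      case True
      then show ?thesis using assms \<open>\<rho> \<ge> 0\<close> k by simp
    next
      case False
      have other: "?I y \<le> D + R * exp (\<eta> * real n)" for y
      proof -
        have "?I y \<le> avg_words k W (\<lambda>w. avg_words k (t + m) (\<lambda>u. defect n (c # w) u))"
          by (intro avg_words_mono defect_Cons_text)
        also have "\<dots> \<le> D + R * exp (\<eta> * real n)" using c W by (intro IH) auto
        finally show ?thesis .
      qed
      have match: "?I c \<le> D + R * exp (\<eta> * real n) * exp (- \<eta>)"
      proof -
        have "?I c \<le> avg_words k W (\<lambda>w. avg_words k (t + m) (\<lambda>u. defect (n - 1) w u))"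
          by (intro avg_words_mono defect_match)
        also have "\<dots> = (\<Sum>x=1..k. avg_words k W' (\<lambda>w. avg_words k (t + m) (\<lambda>u. defect (n - 1) (x # w) u))) / real k"
          by (simp add: W' avg_words_Suc)
        also have "\<dots> \<le> (\<Sum>x=1..k. D + R * exp (\<eta> * real (n - 1))) / real k"
          using W' by (intro divide_right_mono sum_mono IH) auto
        also have "\<dots> = D + R * exp (\<eta> * real (n - 1))" using k by simp
        also have "exp (\<eta> * real (n - 1)) = exp (\<eta> * real n) * exp (- \<eta>)"
          using False by (simp add: of_nat_diff algebra_simps flip: exp_add)
        finally show ?thesis by (simp add: mult_ac)
      qed
      have "avg_words k W (\<lambda>w. avg_words k (Suc t + m) (\<lambda>u. defect n (c # w) u)) = (\<Sum>y=1..k. ?I y) / real k"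
        by (simp add: avg_avg_words_Suc)
      also have "\<dots> \<le> (\<Sum>y=1..k. if y = c then D + R * exp (\<eta> * real n) * exp (- \<eta>) else D + R * exp (\<eta> * real n)) / real k"
        using match other by (intro divide_right_mono sum_mono) auto
      also have "\<dots> = D + R * \<rho> * exp (\<eta> * real n)"
        using c k by (subst sum_single_point) (auto simp: \<rho>_def field_simps)
      finally show ?thesis by (simp add: R_def mult_ac)
    qed
  qed
qed

section \<open>Second order bound for the advance of the two runs\<close>

definition decay :: real where
  "decay = 1 - (1 - 1 / real k) / (real k * (real h)\<^sup>2)"

text \<open>The first run matches \<open>t/k\<close> letters on average; the final gap
  \<open>H \<le> h\<close> adds at least \<open>H^2 / h = h - (h^2 - H^2) / h\<close>, and the
  potential bounds \<open>h^2 - H^2\<close>.\<close>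

definition advance :: "nat \<Rightarrow> nat list \<Rightarrow> real" where
  "advance t s = real t / real k + real h - decay ^ t * potential h s / real h"

text \<open>A second order upper bound for the expectation of \<open>exp (- \<eta> X)\<close>, where \<open>X \<le> t + h\<close> has mean at least
  \<open>advance t s\<close>.\<close>

definition laplace_bound :: "nat \<Rightarrow> nat list \<Rightarrow> real" where
  "laplace_bound t s = 1 - \<eta> * advance t s + \<eta>\<^sup>2 * (real t + real h + 1)\<^sup>2"

lemma decay_bounds: "0 \<le> decay" "decay \<le> 1"
proof -
  have "(1 - 1 / real k) / (real k * (real h)\<^sup>2) \<le> 1 / 1"
    using k h by (intro frac_le) (auto simp: mult_ge1_I)
  then show "0 \<le> decay" by (simp add: decay_def)
  show "decay \<le> 1" using k by (simp add: decay_def)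
qed

lemma potential_bounds:
  assumes "2 \<le> length s" "length s \<le> Suc h"
  shows "0 \<le> potential h s" "potential h s \<le> (real h)\<^sup>2"
proof -
  have "1 \<le> (real (length s - 1))\<^sup>2" using assms by simp
  then show "potential h s \<le> (real h)\<^sup>2" by (simp add: potential_def)
  have "(real (length s - 1))\<^sup>2 \<le> (real h)\<^sup>2" using assms by (intro power_mono) auto
  then show "0 \<le> potential h s" by (simp add: potential_def)
qed

lemma advance_bounds:
  assumes "2 \<le> length s" "length s \<le> Suc h"
  shows "0 \<le> advance t s" "advance t s \<le> real t + real h"
proof -
  have "decay ^ t * potential h s \<le> 1 * (real h)\<^sup>2"
    using potential_bounds[OF assms] decay_bounds by (intro mult_mono power_le_one) auto
  then have "decay ^ t * potential h s / real h \<le> real h"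
    using h by (simp add: divide_le_eq power2_eq_square)
  then show "0 \<le> advance t s" unfolding advance_def by (smt (verit) divide_nonneg_nonneg of_nat_0_le_iff)
  have "0 \<le> decay ^ t * potential h s / real h"
    using potential_bounds[OF assms] decay_bounds by auto
  moreover have "real t / real k \<le> real t / 1" using k by (intro divide_left_mono) auto
  ultimately show "advance t s \<le> real t + real h" unfolding advance_def by simp
qed

text \<open>The bound has the shape \<open>1 - x + x^2\<close>; its sign is needed when
  \<open>exp (- \<eta>)\<close> is replaced by a larger factor.\<close>

lemma laplace_bound_nonneg:
  assumes "2 \<le> length s" "length s \<le> Suc h"
  shows "0 \<le> laplace_bound t s"
proof -
  have "(advance t s)\<^sup>2 \<le> (real t + real h + 1)\<^sup>2"
    using advance_bounds[OF assms, of t] by (intro power_mono) auto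
  then have "\<eta>\<^sup>2 * (advance t s)\<^sup>2 \<le> \<eta>\<^sup>2 * (real t + real h + 1)\<^sup>2" by (intro mult_left_mono) auto
  moreover have "0 \<le> (1 - \<eta> * advance t s / 2)\<^sup>2" by simp
  moreover have "0 \<le> (\<eta> * advance t s)\<^sup>2" by simp
  ultimately show ?thesis
    unfolding laplace_bound_def by (simp add: power2_eq_square algebra_simps)
qed

text \<open>First order terms follow the drift of the potential; cross terms of second order are
  absorbed as the square grows with \<open>t\<close>.\<close>

lemma laplace_bound_step:
  assumes s: "set s \<subseteq> {1..k}" "2 \<le> length s" "length s \<le> h"
  shows "(\<Sum>y=1..k. \<Sum>x=1..k. exp (- \<eta> * of_bool (y = hd s)) * laplace_bound t (run_step s y x)) / (real k)\<^sup>2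
    \<le> laplace_bound (Suc t) s"
proof -
  define K where "K = (real t + real h + 1)\<^sup>2"
  define K' where "K' = (real (Suc t) + real h + 1)\<^sup>2"
  \<comment> \<open>Room for the terms \<open>\<eta>^2\<close> and \<open>\<eta>^2 * advance\<close>
    produced by a match.\<close>
  have K': "K' \<ge> K + (real t + real h) + 1" by (simp add: K_def K'_def power2_eq_square algebra_simps)
  have K0: "K \<ge> 0" by (simp add: K_def)
  have term_le: "exp (- \<eta> * of_bool (y = hd s)) * laplace_bound t (run_step s y x) \<le>
      1 - \<eta> * (of_bool (y = hd s) + advance t (run_step s y x)) + \<eta>\<^sup>2 * K'"
    if "x \<in> {1..k}" for x y
  proof -
    let ?s = "run_step s y x"
    have l: "2 \<le> length ?s" "length ?s \<le> Suc h"
      using length_run_step_ge[of s y x] length_run_step_le[of s y x] s by auto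
    note b = advance_bounds[OF l, of t] laplace_bound_nonneg[OF l, of t]
    show ?thesis
    proof (cases "y = hd s")
      case True
      have "exp (- \<eta>) * laplace_bound t ?s \<le> (1 - \<eta> + \<eta>\<^sup>2) * laplace_bound t ?s"
        using b \<eta> by (intro mult_right_mono exp_minus_le) auto
      also have "\<dots> = 1 - \<eta> * (1 + advance t ?s) + \<eta>\<^sup>2 * (K + advance t ?s + 1)
          - \<eta>\<^sup>2 * (\<eta> * advance t ?s) - \<eta>\<^sup>2 * ((\<eta> - \<eta>\<^sup>2) * K)"
        unfolding laplace_bound_def K_def[symmetric] by (simp add: algebra_simps power2_eq_square)
      also have "\<dots> \<le> 1 - \<eta> * (1 + advance t ?s) + \<eta>\<^sup>2 * (K + advance t ?s + 1)"
      proof -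
        have "\<eta>\<^sup>2 \<le> \<eta>" using \<eta> by (simp add: power2_eq_square mult_left_le)
        then have "0 \<le> \<eta>\<^sup>2 * ((\<eta> - \<eta>\<^sup>2) * K)" using K0 by (intro mult_nonneg_nonneg) auto
        moreover have "0 \<le> \<eta>\<^sup>2 * (\<eta> * advance t ?s)" using b \<eta> by (intro mult_nonneg_nonneg) auto
        ultimately show ?thesis by linarith
      qed
      also have "\<dots> \<le> 1 - \<eta> * (1 + advance t ?s) + \<eta>\<^sup>2 * K'"
        using K' b by (intro add_left_mono mult_left_mono) auto
      finally show ?thesis using True by simp
    next
      case False
      have "\<eta>\<^sup>2 * K \<le> \<eta>\<^sup>2 * K'" using K' by (intro mult_left_mono) auto
      then show ?thesis using False by (simp add: laplace_bound_def K_def)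
    qed
  qed
  have hd: "hd s \<in> {1..k}" using s hd_in_set[of s] by fastforce
  define P where "P = (\<Sum>y=1..k. \<Sum>x=1..k. potential h (run_step s y x)) / (real k)\<^sup>2"
  have P: "P \<le> decay * potential h s"
    unfolding P_def decay_def using k s by (intro potential_drift) auto
  have "(\<Sum>y=1..k. \<Sum>x=1..k. exp (- \<eta> * of_bool (y = hd s)) * laplace_bound t (run_step s y x)) / (real k)\<^sup>2
     \<le> (\<Sum>y=1..k. \<Sum>x=1..k. 1 - \<eta> * (of_bool (y = hd s) + advance t (run_step s y x)) + \<eta>\<^sup>2 * K') / (real k)\<^sup>2"
    by (intro divide_right_mono sum_mono term_le) auto
  also have "\<dots> = (\<Sum>y=1..k. \<Sum>x=1..k. (1 - \<eta> * (real t / real k + real h) + \<eta>\<^sup>2 * K') - \<eta> * of_bool (y = hd s)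
      + \<eta> * decay ^ t / real h * potential h (run_step s y x)) / (real k)\<^sup>2"
    by (intro arg_cong2[where f = "(/)"] sum.cong refl) (simp add: advance_def algebra_simps)
  also have "\<dots> = (1 - \<eta> * (real t / real k + real h) + \<eta>\<^sup>2 * K') - \<eta> / real k + \<eta> * decay ^ t / real h * P"
  proof -
    have "(\<Sum>y=1..k. \<Sum>x=1..k. \<eta> * of_bool (y = hd s)) = real k * \<eta>"
      using hd by (simp add: of_bool_def if_distrib sum_distrib_left[symmetric] cong: if_cong)
    moreover have "(\<Sum>y=1..k. \<Sum>x=1..k. \<eta> * decay ^ t / real h * potential h (run_step s y x)) =
       \<eta> * decay ^ t / real h * (P * (real k)\<^sup>2)"
      using k by (simp add: P_def sum_distrib_left)
    ultimately show ?thesis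
      using k by (simp only: sum.distrib sum_subtractf) (simp add: field_simps power2_eq_square)
  qed
  also have "\<dots> \<le> (1 - \<eta> * (real t / real k + real h) + \<eta>\<^sup>2 * K') - \<eta> / real k + \<eta> * decay ^ t / real h * (decay * potential h s)"
    using P \<eta> decay_bounds by (intro add_left_mono mult_left_mono) auto
  also have "\<dots> = laplace_bound (Suc t) s"
    unfolding laplace_bound_def advance_def K'_def by (simp add: algebra_simps add_divide_distrib)
  finally show ?thesis .
qed

text \<open>At gap \<open>h\<close> only the second run is followed: it is \<open>h\<close> ahead
  and matches greedily during the other \<open>t\<close> letters.\<close>

lemma exp_frozen_le_laplace_bound:
  assumes "length s = Suc h"
  shows "exp (- \<eta> * real h) * (1 - (1 - exp (- \<eta>)) / real k) ^ t \<le> laplace_bound t s"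
proof -
  define \<rho> where "\<rho> = 1 - (1 - exp (- \<eta>)) / real k"
  define a where "a = real t / real k"
  have a: "0 \<le> a" "a \<le> real t"
    using k by (auto simp: a_def divide_le_eq mult_le_cancel_left1)
  \<comment> \<open>The deficit \<open>\<eta>\<^sup>2 * a\<close> comes from
    \<open>1 - exp (- \<eta>) \<ge> \<eta> - \<eta>\<^sup>2\<close> and is of second order.\<close>
  define z where "z = \<eta> * (a + real h) - \<eta>\<^sup>2 * a"
  have \<eta>2: "\<eta>\<^sup>2 \<le> \<eta>" using \<eta> by (simp add: power2_eq_square mult_left_le)
  then have "\<eta>\<^sup>2 * a \<le> \<eta> * a" using a by (intro mult_right_mono)
  then have z0: "0 \<le> z" using \<eta> by (simp add: z_def distrib_left add_increasing2)
  have zle: "z \<le> \<eta> * (a + real h)" using a by (simp add: z_def)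
  have "0 \<le> \<rho>"
  proof -
    have "(1 - exp (- \<eta>)) / real k \<le> 1" using k exp_gt_zero[of "- \<eta>"] by (simp add: divide_le_eq del: exp_gt_zero)
    then show ?thesis by (simp add: \<rho>_def)
  qed
  have "\<rho> \<le> 1 + (- (\<eta> - \<eta>\<^sup>2) / real k)"
    using divide_right_mono[OF exp_minus_le[of \<eta>], of "real k"] \<eta> by (simp add: \<rho>_def diff_divide_distrib add_divide_distrib)
  also have "\<dots> \<le> exp (- (\<eta> - \<eta>\<^sup>2) / real k)" by (rule exp_ge_add_one_self)
  finally have "\<rho> ^ t \<le> exp (- (\<eta> - \<eta>\<^sup>2) / real k) ^ t" using \<open>0 \<le> \<rho>\<close> by (intro power_mono)
  also have "\<dots> = exp (- (\<eta> - \<eta>\<^sup>2) * a)" by (simp add: a_def flip: exp_of_nat2_mult)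
  finally have "exp (- \<eta> * real h) * \<rho> ^ t \<le> exp (- \<eta> * real h) * exp (- (\<eta> - \<eta>\<^sup>2) * a)"
    by (intro mult_left_mono) auto
  also have "\<dots> = exp (- z)" by (simp add: z_def algebra_simps flip: exp_add)
  also have "\<dots> \<le> 1 - z + z\<^sup>2" using z0 by (rule exp_minus_le)
  also have "\<dots> \<le> 1 - z + (\<eta> * (a + real h))\<^sup>2" using z0 zle by (intro add_left_mono power_mono)
  also have "\<dots> = 1 - \<eta> * (a + real h) + \<eta>\<^sup>2 * (a + (a + real h)\<^sup>2)"
    unfolding z_def power_mult_distrib by (simp add: algebra_simps)
  also have "\<dots> \<le> 1 - \<eta> * (a + real h) + \<eta>\<^sup>2 * (real t + real h + 1)\<^sup>2"
  proof (intro add_left_mono mult_left_mono)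
    have "a + (a + real h)\<^sup>2 \<le> a + (real t + real h)\<^sup>2"
      using a by (intro add_left_mono power_mono) auto
    also have "\<dots> \<le> (real t + real h + 1)\<^sup>2"
      using a by (simp add: power2_eq_square algebra_simps)
    finally show "a + (a + real h)\<^sup>2 \<le> (real t + real h + 1)\<^sup>2" .
  qed auto
  also have "\<dots> = laplace_bound t s"
    using assms by (simp add: laplace_bound_def advance_def potential_def a_def)
  finally show ?thesis by (simp add: \<rho>_def)
qed

lemma exp_gap_le_laplace_bound:
  assumes s: "2 \<le> length s" "length s \<le> h"
  shows "exp (- \<eta> * real (length s - 1)) \<le> laplace_bound 0 s"
proof -
  define H where "H = real (length s - 1)"
  have H: "0 \<le> H" "H \<le> real h" using s by (auto simp: H_def)
  have "H\<^sup>2 \<le> H * real h" using H by (simp add: power2_eq_square mult_left_mono)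
  then have "H\<^sup>2 / real h \<le> H" using h by (simp add: divide_le_eq)
  moreover have "advance 0 s \<le> H\<^sup>2 / real h"
    using s h by (simp add: advance_def potential_def H_def field_simps power2_eq_square)
  ultimately have adv: "advance 0 s \<le> H" by linarith
  have "exp (- (\<eta> * H)) \<le> 1 - \<eta> * H + (\<eta> * H)\<^sup>2" using H \<eta> by (intro exp_minus_le) auto
  also have "\<dots> = 1 - \<eta> * H + \<eta>\<^sup>2 * H\<^sup>2" by (simp add: power_mult_distrib)
  also have "\<dots> \<le> 1 - \<eta> * advance 0 s + \<eta>\<^sup>2 * (real 0 + real h + 1)\<^sup>2"
    using H adv \<eta> by (intro add_mono diff_left_mono mult_left_mono power_mono) auto
  finally show ?thesis by (simp add: laplace_bound_def H_def)
qed

text \<open>When the piece ends or the gap reaches \<open>h\<close>, commit to the second run and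
  pay its skip.\<close>

lemma avg_gap_defect_stop:
  assumes base: "defect_bound D A m W0" and DA: "D \<ge> 0" "A \<ge> 0"
    and s: "set s \<subseteq> {1..k}" "2 \<le> length s" "length s \<le> Suc h" and W: "t + W0 \<le> W"
    and stop: "t = 0 \<or> length s = Suc h"
  shows "avg_words k W (\<lambda>w. avg_words k (t + m) (\<lambda>u. gap_defect n (length s - 1) (s @ w) u)) \<le>
    D + 1 + A * exp (\<eta> * real n) * laplace_bound t s"
proof -
  define H where "H = length s - 1"
  define Q where "Q = A * (1 - (1 - exp (- \<eta>)) / real k) ^ t"
  have last: "last s \<in> {1..k}" using s last_in_set[of s] by fastforce
  have drop: "drop H (s @ w) = last s # w" for w
    using s by (subst append_butlast_last_id[of s, symmetric]) (auto simp: H_def)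
  have "avg_words k W (\<lambda>w. avg_words k (t + m) (\<lambda>u. gap_defect n H (s @ w) u)) \<le>
      avg_words k W (\<lambda>w. avg_words k (t + m) (\<lambda>u. 1 + defect (n - H) (last s # w) u))"
    by (intro avg_words_mono) (simp add: gap_defect_def drop del: drop_append)
  also have "\<dots> = 1 + avg_words k W (\<lambda>w. avg_words k (t + m) (\<lambda>u. defect (n - H) (last s # w) u))"
    using k by (simp add: avg_words_add)
  also have "\<dots> \<le> D + 1 + A * exp (\<eta> * real n) * laplace_bound t s"
  proof (cases "H \<le> n")
    case True
    have "exp (- \<eta> * real H) * (1 - (1 - exp (- \<eta>)) / real k) ^ t \<le> laplace_bound t s"
    proof (cases "length s = Suc h")
      case True
      then show ?thesis using exp_frozen_le_laplace_bound[of s t] by (simp add: H_def)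
    next
      case False
      then show ?thesis using exp_gap_le_laplace_bound[of s] s stop by (simp add: H_def)
    qed
    then have "A * exp (\<eta> * real n) * (exp (- \<eta> * real H) * (1 - (1 - exp (- \<eta>)) / real k) ^ t) \<le>
        A * exp (\<eta> * real n) * laplace_bound t s"
      using DA by (intro mult_left_mono) auto
    moreover have "exp (\<eta> * real (n - H)) = exp (\<eta> * real n) * exp (- \<eta> * real H)"
      using True by (simp add: of_nat_diff algebra_simps flip: exp_add)
    moreover have "avg_words k W (\<lambda>w. avg_words k (t + m) (\<lambda>u. defect (n - H) (last s # w) u)) \<le>
        D + Q * exp (\<eta> * real (n - H))"
      using defect_bound_single_run[OF base DA, of t] last W unfolding defect_bound_def Q_def by blast
    ultimately show ?thesis by (simp add: Q_def mult_ac)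
  next
    \<comment> \<open>The second run has already passed the goal.\<close>
    case False
    then show ?thesis using k DA laplace_bound_nonneg[OF s(2,3), of t] by simp
  qed
  finally show ?thesis by (simp add: H_def)
qed

text \<open>Reveal one text letter and, if required, one fresh word letter, then apply
  \<open>run_step\<close>. The single skip is charged only on stopping.\<close>

lemma avg_gap_defect_le:
  assumes base: "defect_bound D A m W0" and DA: "D \<ge> 0" "A \<ge> 0"
    and s: "set s \<subseteq> {1..k}" "2 \<le> length s" "length s \<le> Suc h" and W: "t + W0 \<le> W"
  shows "avg_words k W (\<lambda>w. avg_words k (t + m) (\<lambda>u. gap_defect n (length s - 1) (s @ w) u)) \<le>
    D + 1 + A * exp (\<eta> * real n) * laplace_bound t s"
  using s W
proof (induction t arbitrary: s n W)
  case 0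
  then show ?case using avg_gap_defect_stop[OF base DA, of s 0 W n] by simp
next
  case (Suc t)
  note s = Suc.prems(1-3)
  show ?case
  proof (cases "length s = Suc h \<or> n = 0")
    case True
    show ?thesis
    proof (cases "length s = Suc h")
      case True
      then show ?thesis using avg_gap_defect_stop[OF base DA s Suc.prems(4), of n] by simp
    next
      case False
      then show ?thesis
        using True laplace_bound_nonneg[OF s(2,3), of "Suc t"] k DA by (simp add: gap_defect_0)
    qed
  next
    case False
    then have len: "length s \<le> h" and n: "n \<ge> 1" using s by auto
    obtain W' where W': "W = Suc W'" "t + W0 \<le> W'" using Suc.prems(4) by (cases W) auto
    let ?I = "\<lambda>y. avg_words k W (\<lambda>w. avg_words k (t + m) (\<lambda>u. gap_defect n (length s - 1) (s @ w) (y # u)))"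
    let ?J = "\<lambda>W y x. avg_words k W (\<lambda>w. avg_words k (t + m) (\<lambda>u.
        gap_defect (n - of_bool (y = hd s)) (length (run_step s y x) - 1) (run_step s y x @ w) u))"
    \<comment> \<open>Any \<open>V\<close> is allowed because revealing a fresh letter leaves
      \<open>W'\<close> random ones, otherwise all \<open>W\<close> remain.\<close>
    have J: "?J V y x \<le> D + 1 + A * exp (\<eta> * real n) * (exp (- \<eta> * of_bool (y = hd s)) * laplace_bound t (run_step s y x))"
      if "x \<in> {1..k}" "t + W0 \<le> V" for V x y
    proof -
      have l: "2 \<le> length (run_step s y x)" "length (run_step s y x) \<le> Suc h"
        using length_run_step_ge[of s y x] length_run_step_le[of s y x] s len by auto
      have "?J V y x \<le> D + 1 + A * exp (\<eta> * real (n - of_bool (y = hd s))) * laplace_bound t (run_step s y x)"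
        using that l s by (intro Suc.IH set_run_step) auto
      moreover have "exp (\<eta> * real (n - of_bool (y = hd s))) = exp (\<eta> * real n) * exp (- \<eta> * of_bool (y = hd s))"
        using n by (simp add: of_nat_diff algebra_simps flip: exp_add)
      ultimately show ?thesis by (simp add: mult_ac)
    qed
    have I: "?I y \<le> (\<Sum>x=1..k. D + 1 + A * exp (\<eta> * real n) * (exp (- \<eta> * of_bool (y = hd s)) * laplace_bound t (run_step s y x))) / real k"
      for y
    proof (cases "needs_fresh s y")
      case True
      have "?I y = (\<Sum>x=1..k. avg_words k W' (\<lambda>w. avg_words k (t + m) (\<lambda>u.
          gap_defect n (length s - 1) (s @ x # w) (y # u)))) / real k"
        by (simp add: W' avg_words_Suc)
      also have "\<dots> \<le> (\<Sum>x=1..k. ?J W' y x) / real k"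
      proof (intro divide_right_mono sum_mono avg_words_mono)
        fix x w u
        show "gap_defect n (length s - 1) (s @ x # w) (y # u) \<le>
          gap_defect (n - of_bool (y = hd s)) (length (run_step s y x) - 1) (run_step s y x @ w) u"
          using gap_defect_run_step[of s n y x w u] True s by simp
      qed auto
      also have "\<dots> \<le> (\<Sum>x=1..k. D + 1 + A * exp (\<eta> * real n) * (exp (- \<eta> * of_bool (y = hd s)) * laplace_bound t (run_step s y x))) / real k"
        using W' by (intro divide_right_mono sum_mono J) auto
      finally show ?thesis .
    next
      case False
      \<comment> \<open>No fresh letter is used, so the average over \<open>x\<close> is a dummy and
        1 an arbitrary representative.\<close>
      have const: "run_step s y x = run_step s y 1" for x
        using False by (simp add: run_step_def)
      have "?I y \<le> ?J W y 1"
      proof (intro avg_words_mono)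
        fix w u
        show "gap_defect n (length s - 1) (s @ w) (y # u) \<le>
          gap_defect (n - of_bool (y = hd s)) (length (run_step s y 1) - 1) (run_step s y 1 @ w) u"
          using gap_defect_run_step[of s n y 1 w u] False s by simp
      qed
      also have "\<dots> \<le> D + 1 + A * exp (\<eta> * real n) * (exp (- \<eta> * of_bool (y = hd s)) * laplace_bound t (run_step s y 1))"
        using W' k by (intro J) auto
      also have "\<dots> = (\<Sum>x=1..k. D + 1 + A * exp (\<eta> * real n) * (exp (- \<eta> * of_bool (y = hd s)) * laplace_bound t (run_step s y 1))) / real k"
        using k by simp
      finally show ?thesis by (subst const)
    qed
    have "avg_words k W (\<lambda>w. avg_words k (Suc t + m) (\<lambda>u. gap_defect n (length s - 1) (s @ w) u)) =
        (\<Sum>y=1..k. ?I y) / real k"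
      by (simp add: avg_avg_words_Suc)
    also have "\<dots> \<le> (\<Sum>y=1..k. (\<Sum>x=1..k. D + 1 + A * exp (\<eta> * real n) * (exp (- \<eta> * of_bool (y = hd s)) * laplace_bound t (run_step s y x))) / real k) / real k"
      by (intro divide_right_mono sum_mono I) auto
    also have "\<dots> = D + 1 + A * exp (\<eta> * real n) *
        ((\<Sum>y=1..k. \<Sum>x=1..k. exp (- \<eta> * of_bool (y = hd s)) * laplace_bound t (run_step s y x)) / (real k)\<^sup>2)"
      (is "?l = ?r")
    proof -
      have "?l = (\<Sum>y=1..k. \<Sum>x=1..k. (D + 1) + A * exp (\<eta> * real n) * (exp (- \<eta> * of_bool (y = hd s)) * laplace_bound t (run_step s y x))) / (real k)\<^sup>2"
        by (simp only: sum_divide_distrib[symmetric] divide_divide_eq_left power2_eq_square add.assoc)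
      also have "\<dots> = ?r"
        using k by (simp only: sum.distrib sum_distrib_left[symmetric] add_divide_distrib)
          (simp add: power2_eq_square)
      finally show ?thesis .
    qed
    also have "\<dots> \<le> D + 1 + A * exp (\<eta> * real n) * laplace_bound (Suc t) s"
      using DA s len by (intro add_left_mono mult_left_mono laplace_bound_step) auto
    finally show ?thesis .
  qed
qed

text \<open>\<open>laplace_bound\<close> at gap 1 with the potential replaced by its maximum
  \<open>h^2\<close>.\<close>

definition block_factor :: "nat \<Rightarrow> real" where
  "block_factor B = 1 - \<eta> * (real B / real k + real h * (1 - decay ^ B)) + \<eta>\<^sup>2 * (real B + real h + 1)\<^sup>2"

lemma laplace_bound_start_le: "laplace_bound B [c, x] \<le> block_factor B"
proof -
  have "decay ^ B * potential h [c, x] / real h \<le> decay ^ B * (real h)\<^sup>2 / real h"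
    using potential_bounds[of "[c, x]"] h decay_bounds
    by (intro divide_right_mono mult_left_mono) auto
  also have "\<dots> = decay ^ B * real h" using h by (simp add: power2_eq_square)
  finally have "real B / real k + real h * (1 - decay ^ B) \<le> advance B [c, x]"
    by (simp add: advance_def algebra_simps)
  then show ?thesis unfolding block_factor_def laplace_bound_def using \<eta> by simp
qed

lemma block_factor_nonneg: "0 \<le> block_factor B"
  using laplace_bound_nonneg[of "[c, c]" B] laplace_bound_start_le[of B c c] h by simp

text \<open>Revealing one more letter gives gap 1, where the plain defect is a gap defect; one skip
  buys the factor.\<close>

lemma defect_bound_block:
  assumes base: "defect_bound D A m W0" and DA: "D \<ge> 0" "A \<ge> 0"
  shows "defect_bound (D + 1) (A * block_factor B) (B + m) (Suc (B + W0))"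
  unfolding defect_bound_def
proof (intro ballI allI impI)
  fix c n W assume c: "c \<in> {1..k}" and "Suc (B + W0) \<le> W"
  then obtain W' where W': "W = Suc W'" "B + W0 \<le> W'" by (cases W) auto
  have "avg_words k W (\<lambda>w. avg_words k (B + m) (\<lambda>u. defect n (c # w) u)) =
      (\<Sum>x=1..k. avg_words k W' (\<lambda>w. avg_words k (B + m) (\<lambda>u. gap_defect n (length [c, x] - 1) ([c, x] @ w) u))) / real k"
    by (simp add: W' avg_words_Suc gap_defect_1[unfolded One_nat_def])
  also have "\<dots> \<le> (\<Sum>x=1..k. D + 1 + A * exp (\<eta> * real n) * laplace_bound B [c, x]) / real k"
    using W' c h by (intro divide_right_mono sum_mono avg_gap_defect_le[OF base DA]) auto
  also have "\<dots> \<le> (\<Sum>x=1..k. D + 1 + A * exp (\<eta> * real n) * block_factor B) / real k"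
    using DA by (intro divide_right_mono sum_mono add_left_mono mult_left_mono laplace_bound_start_le) auto
  also have "\<dots> = D + 1 + A * block_factor B * exp (\<eta> * real n)" using k by (simp add: mult_ac)
  finally show "avg_words k W (\<lambda>w. avg_words k (B + m) (\<lambda>u. defect n (c # w) u)) \<le> D + 1 + A * block_factor B * exp (\<eta> * real n)" .
qed

text \<open>\<open>N\<close> blocks are prepended to the empty text, each at the price of one
  skip.\<close>

lemma expected_LCS_lower:
  "real n - real N - block_factor B ^ N * exp (\<eta> * real n) / \<eta> \<le> expected_LCS k n (N * B)"
proof -
  have bound: "defect_bound (real N) (1 / \<eta> * block_factor B ^ N) (N * B) (N * Suc B)"
  proof (induction N)
    case 0
    \<comment> \<open>With no text all \<open>n\<close> letters are lost, whence the initial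
      constant \<open>1 / \<eta>\<close>.\<close>
    have "real n \<le> 1 / \<eta> * exp (\<eta> * real n)" for n
      using exp_ge_add_one_self[of "\<eta> * real n"] \<eta>
      by (simp add: field_simps del: exp_ge_add_one_self)
    then show ?case using k by (auto simp: defect_bound_def)
  next
    case (Suc N)
    have "defect_bound (real N + 1) (1 / \<eta> * block_factor B ^ N * block_factor B) (B + N * B) (Suc (B + N * Suc B))"
      using \<eta> block_factor_nonneg by (intro defect_bound_block[OF Suc]) auto
    then show ?case by (simp add: mult_ac add_ac)
  qed
  \<comment> \<open>Enough letters for all blocks; those beyond \<open>n\<close> average
    out.\<close>
  define W where "W = N * Suc B + n"
  have "avg_words k (Suc W) (\<lambda>w. avg_words k (N * B) (\<lambda>u. defect n w u)) \<le>
      (\<Sum>c=1..k. real N + 1 / \<eta> * block_factor B ^ N * exp (\<eta> * real n)) / real k"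
    unfolding avg_words_Suc
    using bound unfolding defect_bound_def by (intro divide_right_mono sum_mono) (auto simp: W_def)
  also have "\<dots> = real N + block_factor B ^ N * exp (\<eta> * real n) / \<eta>" using k by simp
  also have "avg_words k (Suc W) (\<lambda>w. avg_words k (N * B) (\<lambda>u. defect n w u)) =
      avg_words k n (\<lambda>w. avg_words k (N * B) (\<lambda>u. real n - real (LCS w u)))"
    unfolding defect_def using k
    by (intro avg_words_take[where f = "\<lambda>w. avg_words k (N * B) (\<lambda>u. real n - real (LCS w u))"]) (auto simp: W_def)
  also have "\<dots> = real n - expected_LCS k n (N * B)"
    using k by (simp add: avg_words_diff expected_LCS_eq)
  finally show ?thesis by simp
qed

end

section \<open>The lower bound\<close>

text \<open>A block must advance by \<open>\<beta>\<close> letters to keep up and advances by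
  \<open>V\<close> to first order. If \<open>V > \<beta>\<close>, the loss is one skip per block, up
  to a constant.\<close>

lemma lcs_gamma_ge_block:
  fixes \<epsilon> :: real
  assumes k: "k \<ge> 2" and h: "h \<ge> 1" and B: "B \<ge> 1" and \<epsilon>: "0 < \<epsilon>" "\<epsilon> < 1"
    and gain: "real B / ((1 - \<epsilon>) * real k) <
      real B / real k + real h * (1 - (1 - (1 - 1 / real k) / (real k * (real h)\<^sup>2)) ^ B)"
  shows "1 - (1 - \<epsilon>) * real k / real B \<le> lcs_gamma k \<epsilon>"
proof -
  define \<beta> where "\<beta> = real B / ((1 - \<epsilon>) * real k)"
  define V where "V = real B / real k + real h * (1 - (1 - (1 - 1 / real k) / (real k * (real h)\<^sup>2)) ^ B)"
  define K where "K = (real B + real h + 1)\<^sup>2"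
  \<comment> \<open>So small that the second order term \<open>\<eta>^2 K\<close> does not exceed
    the surplus \<open>\<eta> (V - \<beta>)\<close>.\<close>
  define \<eta> where "\<eta> = min 1 ((V - \<beta>) / K)"
  have V: "\<beta> < V" using gain by (simp add: V_def \<beta>_def)
  have K: "0 < K" by (simp add: K_def add_nonneg_pos)
  have \<eta>: "0 < \<eta>" "\<eta> \<le> 1" using V K by (auto simp: \<eta>_def)
  have \<eta>K: "\<eta> * K \<le> V - \<beta>" using K by (auto simp: \<eta>_def min_def field_simps)
  interpret reserve_strategy k h \<eta> by unfold_locales (use k h \<eta> in auto)
  have "block_factor B = 1 + (- \<eta> * V + \<eta> * (\<eta> * K))"
    by (simp add: block_factor_def V_def K_def decay_def power2_eq_square)
  also have "\<dots> \<le> exp (- \<eta> * V + \<eta> * (\<eta> * K))" by (rule exp_ge_add_one_self)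
  also have "\<dots> \<le> exp (- \<eta> * \<beta>)"
    using mult_left_mono[OF \<eta>K, of \<eta>] \<eta> by (simp add: algebra_simps)
  finally have factor: "block_factor B \<le> exp (- \<eta> * \<beta>)" .
  define C where "C = exp (\<eta> * \<beta>) / \<eta>"
  let ?m = "\<lambda>n. nat \<lfloor>(1 - \<epsilon>) * real k * real n\<rfloor>"
  have lower: "real n - (1 - \<epsilon>) * real k / real B * real n - C \<le> expected_LCS k n (?m n)" for n
  proof -
    define N where "N = ?m n div B"
    have NB: "N * B \<le> ?m n" by (simp add: N_def)
    have m_le: "real (?m n) \<le> (1 - \<epsilon>) * real k * real n"
      using \<epsilon> by (intro of_nat_floor) auto
    have "real N * real B \<le> (1 - \<epsilon>) * real k * real n"
      using NB m_le by (metis of_nat_le_iff of_nat_mult order_trans)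
    then have N_le: "real N \<le> (1 - \<epsilon>) * real k / real B * real n"
      using B by (simp add: field_simps)
    have "?m n < Suc N * B"
      using B by (simp add: N_def dividend_less_div_times)
    then have "real (?m n) + 1 \<le> (real N + 1) * real B"
      by (metis Suc_eq_plus1 Suc_leI of_nat_1 of_nat_add of_nat_le_iff of_nat_mult)
    moreover have "(1 - \<epsilon>) * real k * real n < real (?m n) + 1" by linarith
    ultimately have "(1 - \<epsilon>) * real k * real n \<le> (real N + 1) * real B" by linarith
    \<comment> \<open>The incomplete last block adds one \<open>\<beta>\<close>, which becomes the
      constant \<open>C\<close>.\<close>
    then have n_le: "real n \<le> (real N + 1) * \<beta>"
      using k \<epsilon> by (simp add: \<beta>_def field_simps)
    have "block_factor B ^ N * exp (\<eta> * real n) \<le> exp (- \<eta> * \<beta>) ^ N * exp (\<eta> * ((real N + 1) * \<beta>))"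
      using factor block_factor_nonneg n_le \<eta> by (intro mult_mono power_mono) auto
    also have "\<dots> = exp (\<eta> * \<beta>)"
      by (simp add: algebra_simps flip: exp_of_nat2_mult exp_add)
    finally have "block_factor B ^ N * exp (\<eta> * real n) / \<eta> \<le> C"
      unfolding C_def using \<eta> by (intro divide_right_mono) auto
    then have "real n - (1 - \<epsilon>) * real k / real B * real n - C \<le> expected_LCS k n (N * B)"
      using expected_LCS_lower[of n N B] N_le by linarith
    also have "\<dots> \<le> expected_LCS k n (?m n)"
      using expected_LCS_super[of k "N * B" 0 "?m n" n 0] expected_LCS_nonneg[of k 0 0] NB k by simp
    finally show ?thesis .
  qed
  have lim: "(\<lambda>n. (1 - (1 - \<epsilon>) * real k / real B) - C / real n) \<longlonglongrightarrow> (1 - (1 - \<epsilon>) * real k / real B) - 0"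
    by (intro tendsto_intros lim_const_over_n)
  have "\<exists>n0. \<forall>n\<ge>n0. (1 - (1 - \<epsilon>) * real k / real B) - C / real n \<le> expected_LCS k n (?m n) / real n"
  proof (intro exI allI impI)
    fix n :: nat assume n: "1 \<le> n"
    have "(1 - (1 - \<epsilon>) * real k / real B) - C / real n = (real n - (1 - \<epsilon>) * real k / real B * real n - C) / real n"
      using n by (simp add: diff_divide_distrib)
    also have "\<dots> \<le> expected_LCS k n (?m n) / real n"
      by (intro divide_right_mono lower) auto
    finally show "(1 - (1 - \<epsilon>) * real k / real B) - C / real n \<le> expected_LCS k n (?m n) / real n" .
  qed
  from LIMSEQ_le[OF lim lcs_gamma_LIMSEQ this] show ?thesis using k \<epsilon> by simp
qed

text \<open>\<open>B\<close> makes one skip per block cost \<open>8 \<epsilon>^2\<close> per letter,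
  and \<open>h\<close> is small enough for the walk to approach gap \<open>h\<close> within a
  block.\<close>

lemma lcs_gamma_lower:
  fixes \<epsilon> :: real
  assumes k: "k \<ge> 2" and \<epsilon>: "0 < \<epsilon>" "\<epsilon> < 1 / 60"
  shows "1 - 8 * \<epsilon>\<^sup>2 \<le> lcs_gamma k \<epsilon>"
proof -
  define h where "h = nat \<lfloor>11 / (50 * \<epsilon>)\<rfloor>"
  define B where "B = nat \<lceil>real k * ((1 - \<epsilon>) / (8 * \<epsilon>\<^sup>2))\<rceil>"
  define \<beta> where "\<beta> = real B / real k"
  define c where "c = (1 - 1 / real k) / (real k * (real h)\<^sup>2)"
  have inv: "60 \<le> 1 / \<epsilon>" using \<epsilon> by (simp add: field_simps)
  have h_le: "real h \<le> 11 / (50 * \<epsilon>)"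
    unfolding h_def using \<epsilon> by (intro of_nat_floor) auto
  have "11 / (50 * \<epsilon>) = 11/50 * (1 / \<epsilon>)" by simp
  \<comment> \<open>The excess \<open>11/50 - 1/5 = 1/50\<close> times
    \<open>1/\<epsilon> \<ge> 60\<close> covers the rounding.\<close>
  then have h_ge: "1/5 * (1 / \<epsilon>) \<le> real h" unfolding h_def using inv by linarith
  then have h1: "h \<ge> 1" using inv by linarith
  have B_ge: "real k * ((1 - \<epsilon>) / (8 * \<epsilon>\<^sup>2)) \<le> real B"
    unfolding B_def by (rule real_nat_ceiling_ge)
  have pos: "0 < (1 - \<epsilon>) / (8 * \<epsilon>\<^sup>2)" using \<epsilon> by auto
  have B_le: "real B \<le> real k * ((1 - \<epsilon>) / (8 * \<epsilon>\<^sup>2)) + 1"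
    unfolding B_def using mult_nonneg_nonneg[of "real k", OF _ less_imp_le[OF pos]] by linarith
  have B1: "B \<ge> 1"
    using B_ge mult_pos_pos[of "real k", OF _ pos] k by (cases B) auto
  have \<beta>_ge: "(1 - \<epsilon>) / (8 * \<epsilon>\<^sup>2) \<le> \<beta>" using B_ge k by (simp add: \<beta>_def field_simps)
  have \<beta>_le: "\<beta> \<le> (1 - \<epsilon>) / (8 * \<epsilon>\<^sup>2) + 1/2"
  proof -
    have "\<beta> \<le> (real k * ((1 - \<epsilon>) / (8 * \<epsilon>\<^sup>2)) + 1) / real k"
      unfolding \<beta>_def using B_le by (intro divide_right_mono) auto
    also have "\<dots> = (1 - \<epsilon>) / (8 * \<epsilon>\<^sup>2) + 1 / real k" using k by (simp add: add_divide_distrib)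
    also have "1 / real k \<le> 1 / 2" using k by (intro divide_left_mono) auto
    finally show ?thesis by simp
  qed
  have h2: "(real h)\<^sup>2 * \<epsilon>\<^sup>2 \<le> (11/50)\<^sup>2"
  proof -
    have "real h * \<epsilon> \<le> 11/50" using h_le \<epsilon> by (simp add: field_simps)
    then have "(real h * \<epsilon>)\<^sup>2 \<le> (11/50)\<^sup>2" using \<epsilon> by (intro power_mono) auto
    then show ?thesis by (simp add: power_mult_distrib)
  qed
  have cB: "5/4 \<le> c * real B"
  proof -
    \<comment> \<open>The value 16 is 8 times the 2 from \<open>1 - 1/k \<ge> 1/2\<close>; finally
      \<open>20 * (11/50)^2 = 0.968\<close>.\<close>
    have "5/4 * (real h)\<^sup>2 * (16 * \<epsilon>\<^sup>2) = 20 * ((real h)\<^sup>2 * \<epsilon>\<^sup>2)" by simp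
    also have "\<dots> \<le> 20 * (11/50)\<^sup>2" using h2 by (intro mult_left_mono) auto
    also have "\<dots> \<le> 1 - \<epsilon>" using \<epsilon> by (simp add: power2_eq_square)
    finally have "5/4 * (real h)\<^sup>2 * (16 * \<epsilon>\<^sup>2) \<le> 1 - \<epsilon>" .
    then have "5/4 * (real h)\<^sup>2 \<le> 1/2 * ((1 - \<epsilon>) / (8 * \<epsilon>\<^sup>2))"
      using \<epsilon> by (simp add: field_simps)
    also have "\<dots> \<le> (1 - 1 / real k) * \<beta>"
      using \<beta>_ge pos k by (intro mult_mono) (auto simp: field_simps)
    finally have "5/4 \<le> (1 - 1 / real k) * \<beta> / (real h)\<^sup>2"
      using h1 by (simp add: le_divide_eq)
    also have "\<dots> = c * real B" by (simp add: c_def \<beta>_def)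
    finally show ?thesis .
  qed
  have "(1 - c) ^ B \<le> 1/3"
  proof -
    have "c \<le> 1 / 1"
      unfolding c_def using k h1 by (intro frac_le) (auto simp: mult_ge1_I)
    then have "(1 - c) ^ B \<le> exp (- c) ^ B"
      using exp_ge_add_one_self[of "- c"] by (intro power_mono) auto
    also have "\<dots> = exp (- (c * real B))" by (simp flip: exp_of_nat2_mult)
    also have "\<dots> \<le> exp (- (5/4))" using cB by simp
    also have "\<dots> \<le> 1/3"
    proof -
      have "(1 + 5/4 / real 5) ^ 5 \<le> exp (5/4 :: real)"
        by (rule exp_ge_one_plus_x_over_n_power_n) auto
      then have "3 \<le> exp (5/4 :: real)" by (simp add: power_divide)
      then show ?thesis by (simp add: exp_minus field_simps)
    qed
    finally show ?thesis .
  qed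
  then have "real h * (2/3) \<le> real h * (1 - (1 - c) ^ B)" by (intro mult_left_mono) auto
  then have gain: "2/15 * (1 / \<epsilon>) \<le> real h * (1 - (1 - c) ^ B)" using h_ge by linarith
  have "\<beta> * (\<epsilon> / (1 - \<epsilon>)) \<le> ((1 - \<epsilon>) / (8 * \<epsilon>\<^sup>2) + 1/2) * (\<epsilon> / (1 - \<epsilon>))"
    using \<beta>_le \<epsilon> by (intro mult_right_mono) auto
  also have "\<dots> = 1/8 * (1 / \<epsilon>) + 1/2 * (\<epsilon> / (1 - \<epsilon>))"
  proof -
    have "(1 - \<epsilon>) / (8 * \<epsilon>\<^sup>2) * (\<epsilon> / (1 - \<epsilon>)) = 1/8 * (1 / \<epsilon>)"
      using \<epsilon> by (simp add: field_simps power2_eq_square)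
    then show ?thesis by (simp only: distrib_right)
  qed
  also have "\<epsilon> / (1 - \<epsilon>) \<le> 1/59" using \<epsilon> by (simp add: divide_le_eq)
  \<comment> \<open>\<open>2/15 - 1/8 = 1/120\<close>, so the surplus is at least
    \<open>1/2\<close>, against an error of \<open>1/118\<close>.\<close>
  finally have "\<beta> * (\<epsilon> / (1 - \<epsilon>)) < real h * (1 - (1 - c) ^ B)" using gain inv by linarith
  moreover have "real B / ((1 - \<epsilon>) * real k) = \<beta> + \<beta> * (\<epsilon> / (1 - \<epsilon>))"
    using \<epsilon> k by (simp add: \<beta>_def field_simps)
  ultimately have "1 - (1 - \<epsilon>) * real k / real B \<le> lcs_gamma k \<epsilon>"
    using \<epsilon> k h1 B1 by (intro lcs_gamma_ge_block[of k h]) (auto simp: \<beta>_def c_def)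
  moreover have "(1 - \<epsilon>) * real k / real B \<le> 8 * \<epsilon>\<^sup>2"
    using B_ge B1 \<epsilon> by (simp add: field_simps)
  ultimately show ?thesis by linarith
qed

theorem theorem1:
  fixes k :: nat and \<epsilon> :: real
  assumes "k \<ge> 2" and "0 < \<epsilon>" and "\<epsilon> < 1 / 60"
  shows "1 - 8 * \<epsilon>\<^sup>2 \<le> lcs_gamma k \<epsilon> \<and> lcs_gamma k \<epsilon> \<le> 1 - \<epsilon>\<^sup>2 / 72"
  using lcs_gamma_lower[OF assms] lcs_gamma_upper[of k \<epsilon>] assms by simp

end
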